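(* Let $(a,b)\subseteq\mathbb{R}$ be a finite or infinite interval and $V:(a,b)\to\mathcal{B}(\mathcal{H})$ a weakly measurable operator-valued function with $\|V(\cdot)\|_{\mathcal{B}(\mathcal{H})}\in L^1_{\mathrm{loc}}((a,b);dx)$. Suppose that $x_0\in(a,b)$, $z\in\mathbb{C}$, $h_0,h_1\in\mathcal{H}$, and $f\in L^1_{\mathrm{loc}}((a,b);dx;\mathcal{H})$. Then there is a unique $\mathcal{H}$-valued solution $y(z,\cdot,x_0)\in W^{2,1}_{\mathrm{loc}}((a,b);dx;\mathcal{H})$ of the initial value problem $$-y''+(V-z)y=f \ \text{ on } (a,b)\setminus E,\qquad y(x_0)=h_0,\quad y'(x_0)=h_1,$$ where the exceptional set $E$ is of Lebesgue measure zero and independent of $z$. Moreover, the following properties hold: (i) For fixed $x_0,x\in(a,b)$ and $z\in\mathbb{C}$, $y(z,x,x_0)$ depends jointly continuously on $h_0,h_1\in\mathcal{H}$ and $f\in L^1_{\mathrm{loc}}((a,b);dx;\mathcal{H})$ in the sense that, writing $y(z,x,x_0;h_0,h_1,f)$ to display the dependence on the data, $$\big\|y(z,x,x_0;h_0,h_1,f)-y(z,x,x_0;\widetilde h_0,\widetilde h_1,\widetilde f)\big\|_{\mathcal{H}}\le C(z,V)\big[\|h_0-\widetilde h_0\|_{\mathcal{H}}+\|h_1-\widetilde h_1\|_{\mathcal{H}}+\|f-\widetilde f\|_{L^1([x_0,x];dx;\mathcal{H})}\big],$$ where $C(z,V)>0$ is a constant. (ii) For fixed $x_0\in(a,b)$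 and $z\in\mathbb{C}$, $y(z,x,x_0)$ is strongly continuously differentiable with respect to $x$ on $(a,b)$. (iii) For fixed $x_0\in(a,b)$ and $z\in\mathbb{C}$, $y'(z,x,x_0)$ is strongly differentiable with respect to $x$ on $(a,b)\setminus E$. (iv) For fixed $x_0,x\in(a,b)$, $y(z,x,x_0)$ and $y'(z,x,x_0)$ are entire with respect to $z$.
   Context: $\mathcal{H}$ is a complex separable Hilbert space with norm $\|\cdot\|_{\mathcal{H}}$ and inner product $(\cdot,\cdot)_{\mathcal{H}}$ (linear in the second argument); $\mathcal{B}(\mathcal{H})$ is the Banach space of bounded linear operators on $\mathcal{H}$. An operator-valued function $V$ is weakly measurable if $x\mapsto (f,V(x)g)_{\mathcal{H}}$ is Lebesgue measurable for all $f,g\in\mathcal{H}$. Integrals of $\mathcal{H}$-valued functions are Bochner integrals; $L^1_{\mathrm{loc}}((a,b);dx;\mathcal{H})$ is the set of (classes of) strongly measurable $\mathcal{H}$-valued functions $f$ with $\|f(\cdot)\|_{\mathcal{H}}$ integrable over compact subintervals of $(a,b)$. $W^{2,1}_{\mathrm{loc}}((a,b);dx;\mathcal{H})$ is the set of $y:(a,b)\to\mathcal{H}$ such that $y(x)=y(x_1)+\int_{x_1}^x y'(t)\,dt$ and $y'(x)=y'(x_1)+\int_{x_1}^x y''(t)\,dt$ with $y',y''\in L^1_{\mathrm{loc}}((a,b);dx;\mathcal{H})$. Derivatives of vector-valued functions are strong (norm) derivatives. In (i), $x_0,x,z$ are fixed and the constant does not depend on the data $h_0,h_1,f,\widetilde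 h_0,\widetilde h_1,\widetilde f$; $L^1([x_0,x];\cdot)$ refers to the compact interval with endpoints $x_0$ and $x$. *)

theory Defs
  imports "HOL-Analysis.Analysis"
begin

text \<open>
  Complex Hilbert spaces, with the inner product linear in the second argument. The real scalar
  multiplication and the norm of \<^class>\<open>banach\<close> are the ones induced by the complex structure.
  Separability is expressed by additionally using the sort \<^class>\<open>second_countable_topology\<close>.
\<close>

class complex_hilbert_space = banach +
  fixes scaleC :: "complex \<Rightarrow> 'a \<Rightarrow> 'a"  (infixr \<open>*\<^sub>C\<close> 75)
    and cinner :: "'a \<Rightarrow> 'a \<Rightarrow> complex"
  assumes scaleC_add_right: "c *\<^sub>C (u + v) = c *\<^sub>C u + c *\<^sub>C v"
    and scaleC_add_left: "(c + d) *\<^sub>C u = c *\<^sub>C u + d *\<^sub>C u"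
    and scaleC_scaleC: "c *\<^sub>C (d *\<^sub>C u) = (c * d) *\<^sub>C u"
    and scaleR_scaleC: "r *\<^sub>R u = complex_of_real r *\<^sub>C u"
    and cinner_commute: "cinner u v = cnj (cinner v u)"
    and cinner_add_right: "cinner u (v + w) = cinner u v + cinner u w"
    and cinner_scaleC_right: "cinner u (c *\<^sub>C v) = c * cinner u v"
    and cinner_self: "cinner u u = complex_of_real ((norm u)\<^sup>2)"

text \<open>
  \<^typ>\<open>'h \<Rightarrow>\<^sub>L 'h\<close> consists of the real-linear bounded operators; the bounded operators of the
  complex space are those that commute with complex scalars, with the same operator norm.
\<close>

definition complex_linear :: "('h::complex_hilbert_space \<Rightarrow>\<^sub>L 'h) \<Rightarrow> bool" where
  "complex_linear T \<longleftrightarrow> (\<forall>c u. T (c *\<^sub>C u) = c *\<^sub>C T u)"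

definition weakly_measurable ::
    "ereal \<Rightarrow> ereal \<Rightarrow> (real \<Rightarrow> 'h::complex_hilbert_space \<Rightarrow>\<^sub>L 'h) \<Rightarrow> bool" where
  "weakly_measurable a b V \<longleftrightarrow>
     (\<forall>u v. (\<lambda>x. cinner u (V x v)) \<in> borel_measurable (lebesgue_on (einterval a b)))"

text \<open>
  Functions on \<open>(a, b)\<close> are represented by total functions whose values outside
  \<^term>\<open>einterval a b\<close> are irrelevant, and classes of functions by their representatives.
  For second countable targets, strong measurability is \<^const>\<open>borel_measurable\<close>.
\<close>

definition L1_loc :: "ereal \<Rightarrow> ereal \<Rightarrow> (real \<Rightarrow> 'h::{banach, second_countable_topology}) set" where
  "L1_loc a b = {f. f \<in> borel_measurable (lebesgue_on (einterval a b)) \<and>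
     (\<forall>c d. {c..d} \<subseteq> einterval a b \<longrightarrow> set_integrable lebesgue {c..d} f)}"

abbreviation strong_deriv :: "(real \<Rightarrow> 'h::real_normed_vector) \<Rightarrow> real \<Rightarrow> 'h" where
  "strong_deriv y \<equiv> \<lambda>x. vector_derivative y (at x)"

text \<open>
  The integral identities force \<open>y\<close> to be differentiable everywhere on \<open>(a, b)\<close> and \<open>y'\<close> almost
  everywhere, so the unspecified value of \<^const>\<open>vector_derivative\<close> at points of
  non-differentiability only affects \<open>y''\<close> on a null set. The integrals are oriented.
\<close>

definition W21_loc :: "ereal \<Rightarrow> ereal \<Rightarrow> (real \<Rightarrow> 'h::{banach, second_countable_topology}) set" where
  "W21_loc a b = {y. strong_deriv y \<in> L1_loc a b \<and> strong_deriv (strong_deriv y) \<in> L1_loc a b \<and>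
     (\<forall>x1 \<in> einterval a b. \<forall>x \<in> einterval a b.
        y x = y x1 + interval_lebesgue_integral lebesgue (ereal x1) (ereal x) (strong_deriv y) \<and>
        strong_deriv y x = strong_deriv y x1 +
          interval_lebesgue_integral lebesgue (ereal x1) (ereal x) (strong_deriv (strong_deriv y)))}"

definition solves_ivp ::
    "ereal \<Rightarrow> ereal \<Rightarrow> (real \<Rightarrow> 'h \<Rightarrow>\<^sub>L 'h) \<Rightarrow> complex \<Rightarrow> real \<Rightarrow> 'h \<Rightarrow> 'h \<Rightarrow> (real \<Rightarrow> 'h) \<Rightarrow>
     real set \<Rightarrow> (real \<Rightarrow> 'h::{complex_hilbert_space, second_countable_topology}) \<Rightarrow> bool" where
  "solves_ivp a b V z x0 h0 h1 f E y \<longleftrightarrow>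
     y \<in> W21_loc a b \<and>
     (\<forall>x \<in> einterval a b - E.
        strong_deriv y differentiable (at x) \<and>
        - strong_deriv (strong_deriv y) x + (V x (y x) - z *\<^sub>C y x) = f x) \<and>
     y x0 = h0 \<and> strong_deriv y x0 = h1"

text \<open>Vector-valued entire functions, with the complex derivative taken in norm.\<close>

definition entire :: "(complex \<Rightarrow> 'h::complex_hilbert_space) \<Rightarrow> bool" where
  "entire g \<longleftrightarrow> (\<forall>z. \<exists>D. ((\<lambda>w. inverse (w - z) *\<^sub>C (g w - g z)) \<longlongrightarrow> D) (at z))"

end

theory Submission
  imports Defs
begin

text \<open>
  Writing \<open>Y = (y, y')\<close>, the initial value problem becomes the integral equation
  \<open>Y x = (h0, h1) + \<integral> F\<^sub>z (t, Y t) dt\<close> from \<open>x0\<close> to \<open>x\<close> in the product space, where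
  \<open>F\<^sub>z (t, (u, v)) = (v, V t u - z u - f t)\<close> is Lipschitz in \<open>(u, v)\<close> with the locally integrable
  constant \<open>w t = 1 + \<bar>z\<bar> + \<parallel>V t\<parallel>\<close>. With \<open>W\<close> the primitive of \<open>w\<close> vanishing at \<open>x0\<close>, integration of
  \<open>w\<close> against the weight \<open>exp (4 \<bar>W\<bar>)\<close> reproduces at most half of that weight
  (\<open>oint_exp_abs_weight\<close>). Hence Picard iteration converges geometrically in the weighted sup norm
  of every compact interval, and the same contraction gives a Gronwall inequality. Existence
  (\<open>caratheodory_existence\<close>) and a stability estimate with an explicit constant
  (\<open>caratheodory_perturbation\<close>) follow, the latter yielding uniqueness and continuous
  dependence on the data.

  The integrand \<open>t \<mapsto> V t (y t)\<close> is only weakly measurable at first sight. In a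
  separable Hilbert space norms can be computed by testing against a countable dense set, so weak
  measurability of \<open>V v\<close> implies strong measurability (\<open>pettis_measurable\<close>); continuity in \<open>v\<close>
  then allows inserting a measurable \<open>y\<close> (\<open>caratheodory_measurable\<close>).

  The exceptional set has to work for all \<open>z\<close> simultaneously, although the integrand
  \<open>V y - z y - f\<close> depends on \<open>z\<close> also through \<open>y\<close>. It consists of the points that fail to be Lebesgue
  points of \<open>f\<close>, of \<open>\<parallel>V\<parallel>\<close>, or of \<open>V v\<close> for some \<open>v\<close> in a countable dense set. At every other point,
  approximating \<open>y x\<close> by such a \<open>v\<close> shows that \<open>V y\<close> has a Lebesgue point for each continuous
  \<open>y\<close> (\<open>lebesgue_point_operator\<close>), and there \<open>y'\<close> is differentiable with the expected derivative.

  For the dependence on \<open>z\<close>, let \<open>D\<close> solve the system at \<open>z\<close> with zero initial data and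
  inhomogeneity \<open>y\<^sub>z\<close>, as obtained by differentiating the equation formally in \<open>z\<close>. Then
  \<open>Y\<^sub>z + (w - z) D\<close> solves the system at \<open>w\<close> up to an error of order \<open>\<bar>w - z\<bar>\<^sup>2\<close>, and the
  stability estimate bounds its distance from \<open>Y\<^sub>w\<close> by a multiple of \<open>\<bar>w - z\<bar>\<^sup>2\<close> for \<open>w\<close> near \<open>z\<close>. So the
  components of \<open>D\<close> are the complex derivatives of those of \<open>Y\<close> in \<open>z\<close> (\<open>integral_solution_entire\<close>).
\<close>

section \<open>Locally integrable functions and the oriented integral\<close>

text \<open>
  The oriented integral occurring in \<^const>\<open>W21_loc\<close>, restricted to real endpoints. It is taken
  over \<^const>\<open>lborel\<close> completed, since \<open>f\<close>, \<open>V v\<close> and \<open>y''\<close> are only Lebesgue measurable.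
\<close>

definition oint :: "real \<Rightarrow> real \<Rightarrow> (real \<Rightarrow> 'a) \<Rightarrow> 'a::{banach, second_countable_topology}" where
  "oint s t f = interval_lebesgue_integral lebesgue (ereal s) (ereal t) f"

lemma einterval_segment_subset:
  assumes "s \<in> einterval a b" "t \<in> einterval a b"
  shows "closed_segment s t \<subseteq> einterval a b"
proof
  fix x assume "x \<in> closed_segment s t"
  then have "ereal s \<le> ereal x \<and> ereal x \<le> ereal t \<or> ereal t \<le> ereal x \<and> ereal x \<le> ereal s"
    by (auto simp: closed_segment_eq_real_ivl split: if_splits)
  then show "x \<in> einterval a b"
    using assms unfolding einterval_iff by (meson less_le_trans le_less_trans)
qed

lemma einterval_Icc_subset:
  "s \<in> einterval a b \<Longrightarrow> t \<in> einterval a b \<Longrightarrow> {s..t} \<subseteq> einterval a b"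
  using einterval_segment_subset[of s a b t]
  by (cases "s \<le> t") (auto simp: closed_segment_eq_real_ivl)

lemma sets_einterval_lebesgue [simp]: "einterval a b \<in> sets lebesgue"
  by (simp add: borel_einterval sets_completionI_sets)

lemma L1_loc_measurable: "f \<in> L1_loc a b \<Longrightarrow> f \<in> borel_measurable (lebesgue_on (einterval a b))"
  by (simp add: L1_loc_def)

lemma L1_loc_integrable: "f \<in> L1_loc a b \<Longrightarrow> {c..d} \<subseteq> einterval a b \<Longrightarrow> set_integrable lebesgue {c..d} f"
  by (simp add: L1_loc_def)

lemma set_borel_measurable_lebesgue_subset:
  fixes f :: "real \<Rightarrow> 'a::{banach, second_countable_topology}"
  assumes f: "f \<in> borel_measurable (lebesgue_on (einterval a b))"
    and S: "S \<in> sets lebesgue" "S \<subseteq> einterval a b"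
  shows "set_borel_measurable lebesgue S f"
proof -
  have "set_borel_measurable lebesgue (einterval a b) f"
    using f unfolding set_borel_measurable_def
    by (subst (asm) borel_measurable_restrict_space_iff) auto
  then show ?thesis by (rule set_borel_measurable_subset[OF _ S])
qed

lemma L1_loc_bound:
  fixes f :: "real \<Rightarrow> 'a::{banach, second_countable_topology}"
    and g :: "real \<Rightarrow> 'b::{banach, second_countable_topology}"
  assumes g: "g \<in> L1_loc a b" and f: "f \<in> borel_measurable (lebesgue_on (einterval a b))"
    and le: "\<And>x. x \<in> einterval a b \<Longrightarrow> norm (f x) \<le> norm (g x)"
  shows "f \<in> L1_loc a b"
  unfolding L1_loc_def
proof (intro CollectI conjI allI impI f)
  fix c d assume cd: "{c..d} \<subseteq> einterval a b"
  show "set_integrable lebesgue {c..d} f"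
    using cd le
    by (intro set_integrable_bound[OF L1_loc_integrable[OF g cd]]
        set_borel_measurable_lebesgue_subset[OF f] AE_I2) (auto simp: subset_iff)
qed

lemma L1_loc_add: "f \<in> L1_loc a b \<Longrightarrow> g \<in> L1_loc a b \<Longrightarrow> (\<lambda>x. f x + g x) \<in> L1_loc a b"
  unfolding L1_loc_def by auto

lemma L1_loc_diff: "f \<in> L1_loc a b \<Longrightarrow> g \<in> L1_loc a b \<Longrightarrow> (\<lambda>x. f x - g x) \<in> L1_loc a b"
  unfolding L1_loc_def by auto

lemma L1_loc_bounded_linear:
  assumes T: "bounded_linear T" and f: "f \<in> L1_loc a b"
  shows "(\<lambda>x. T (f x)) \<in> L1_loc a b"
proof -
  interpret T: bounded_linear T by fact
  have "continuous_on UNIV T" by (rule T.continuous_on) (rule continuous_on_id)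
  then have "T \<in> borel_measurable borel" by (rule borel_measurable_continuous_onI)
  moreover have "set_integrable lebesgue {c..d} (\<lambda>x. T (f x))" if "{c..d} \<subseteq> einterval a b" for c d
    using integrable_bounded_linear[OF T L1_loc_integrable[OF f that, unfolded set_integrable_def]]
    by (simp add: set_integrable_def T.scaleR)
  ultimately show ?thesis
    using L1_loc_measurable[OF f] unfolding L1_loc_def by (auto intro: measurable_compose)
qed

lemma L1_loc_Pair:
  assumes "f \<in> L1_loc a b" "g \<in> L1_loc a b"
  shows "(\<lambda>x. (f x, g x)) \<in> L1_loc a b"
proof -
  have "bounded_linear (\<lambda>u::'a. (u, 0::'b))" "bounded_linear (\<lambda>v::'b. (0::'a, v))"
    by (intro bounded_linear_Pair bounded_linear_ident bounded_linear_zero)+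
  from L1_loc_add[OF L1_loc_bounded_linear[OF this(1) assms(1)] L1_loc_bounded_linear[OF this(2) assms(2)]]
  show ?thesis by simp
qed

lemma L1_loc_norm: "f \<in> L1_loc a b \<Longrightarrow> (\<lambda>x. norm (f x)) \<in> L1_loc a b"
  by (rule L1_loc_bound[of f]) (auto intro: measurable_compose[OF L1_loc_measurable])

lemma continuous_on_measurable_einterval:
  fixes f :: "real \<Rightarrow> 'a::{banach, second_countable_topology}"
  shows "continuous_on (einterval a b) f \<Longrightarrow> f \<in> borel_measurable (lebesgue_on (einterval a b))"
  by (rule continuous_imp_measurable_on_sets_lebesgue) auto

lemma L1_loc_cmult:
  fixes h :: "real \<Rightarrow> real"
  assumes h: "continuous_on (einterval a b) h" and w: "w \<in> L1_loc a b"
  shows "(\<lambda>x. h x *\<^sub>R w x) \<in> L1_loc a b"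
proof -
  have m: "(\<lambda>x. h x *\<^sub>R w x) \<in> borel_measurable (lebesgue_on (einterval a b))"
    by (intro borel_measurable_scaleR continuous_on_measurable_einterval h L1_loc_measurable w)
  show ?thesis unfolding L1_loc_def
  proof (intro CollectI conjI allI impI m)
    fix c d assume cd: "{c..d} \<subseteq> einterval a b"
    have "compact (h ` {c..d})"
      using h cd by (intro compact_continuous_image) (auto intro: continuous_on_subset)
    then obtain M where M: "\<And>x. x \<in> {c..d} \<Longrightarrow> norm (h x) \<le> M"
      using compact_imp_bounded bounded_iff by (metis imageI)
    show "set_integrable lebesgue {c..d} (\<lambda>x. h x *\<^sub>R w x)"
    proof (rule set_integrable_bound)
      show "set_integrable lebesgue {c..d} (\<lambda>x. M *\<^sub>R w x)"
        using L1_loc_integrable[OF w cd] by auto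
      show "set_borel_measurable lebesgue {c..d} (\<lambda>x. h x *\<^sub>R w x)"
        by (rule set_borel_measurable_lebesgue_subset[OF m _ cd]) simp
      have "norm (h x *\<^sub>R w x) \<le> norm (M *\<^sub>R w x)" if "x \<in> {c..d}" for x
        using M[OF that] by (auto intro!: mult_right_mono)
      then show "AE x in lebesgue. x \<in> {c..d} \<longrightarrow> norm (h x *\<^sub>R w x) \<le> norm (M *\<^sub>R w x)"
        by auto
    qed
  qed
qed

lemma L1_loc_times:
  fixes h w :: "real \<Rightarrow> real"
  shows "continuous_on (einterval a b) h \<Longrightarrow> w \<in> L1_loc a b \<Longrightarrow> (\<lambda>x. w x * h x) \<in> L1_loc a b"
  using L1_loc_cmult[of a b h w] by (simp add: mult.commute)

lemma L1_loc_const: "(\<lambda>_. c) \<in> L1_loc a b"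
  unfolding L1_loc_def set_integrable_def
  by (auto intro!: integrable_scaleR_left simp: integrable_indicator_iff emeasure_completion emeasure_lborel_Icc_eq)

lemma L1_loc_continuous:
  fixes f :: "real \<Rightarrow> 'a::{banach, second_countable_topology}"
  assumes f: "continuous_on (einterval a b) f"
  shows "f \<in> L1_loc a b"
proof (rule L1_loc_bound)
  show "(\<lambda>x. norm (f x) *\<^sub>R (1::real)) \<in> L1_loc a b"
    by (intro L1_loc_cmult L1_loc_const continuous_intros f)
qed (auto intro: continuous_on_measurable_einterval f)

text \<open>
  Completeness of Lebesgue measure makes measurability insensitive to changes on a null set.
  This is what transfers local integrability to \<open>y''\<close>, whose values on the exceptional set are
  arbitrary.
\<close>

lemma L1_loc_cong_AE:
  fixes f g :: "real \<Rightarrow> 'a::{banach, second_countable_topology}"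
  assumes f: "f \<in> L1_loc a b" and N: "N \<in> null_sets lebesgue"
    and eq: "\<And>x. x \<in> einterval a b - N \<Longrightarrow> f x = g x"
  shows "g \<in> L1_loc a b"
proof -
  let ?I = "einterval a b"
  have m: "g \<in> borel_measurable (lebesgue_on ?I)"
  proof -
    have "(\<lambda>x. indicator ?I x *\<^sub>R f x) \<in> borel_measurable lebesgue"
      using L1_loc_measurable[OF f] by (subst (asm) borel_measurable_restrict_space_iff) auto
    then have mf: "(\<lambda>x. indicator ?I x *\<^sub>R f x) -` S \<inter> UNIV \<in> sets lebesgue" if "S \<in> sets borel" for S
      using that by (auto dest: measurable_sets)
    have "(\<lambda>x. indicator ?I x *\<^sub>R g x) \<in> borel_measurable lebesgue"
    proof (rule measurableI)
      fix S :: "'a set" assume S: "S \<in> sets borel"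
      let ?F = "(\<lambda>x. indicator ?I x *\<^sub>R f x) -` S" and ?G = "(\<lambda>x. indicator ?I x *\<^sub>R g x) -` S"
      have *: "(indicator ?I x :: real) *\<^sub>R f x = indicator ?I x *\<^sub>R g x" if "x \<notin> N" for x
        using eq[of x] that by (cases "x \<in> ?I") simp_all
      have "x \<in> ?G \<longleftrightarrow> x \<in> (?F - N) \<union> (?G \<inter> N)" for x
        using *[of x] by (cases "x \<in> N") (simp_all only: vimage_eq Un_iff Diff_iff Int_iff not_True_eq_False simp_thms)
      then have G_eq: "?G = (?F - N) \<union> (?G \<inter> N)" by blast
      have GN: "?G \<inter> N \<in> null_sets lebesgue"
        using N by (rule null_sets_completion_subset[rotated]) auto
      have "(?F - N) \<union> (?G \<inter> N) \<in> sets lebesgue"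
        by (rule sets.Un[OF sets.Diff[OF mf[OF S, unfolded Int_UNIV_right] null_setsD2[OF N]] null_setsD2[OF GN]])
      then show "?G \<inter> space lebesgue \<in> sets lebesgue"
        unfolding G_eq[symmetric] by simp
    qed simp
    then show ?thesis by (subst borel_measurable_restrict_space_iff) auto
  qed
  show ?thesis unfolding L1_loc_def
  proof (intro CollectI conjI allI impI m)
    fix c d assume cd: "{c..d} \<subseteq> ?I"
    have "AE x in lebesgue. x \<in> {c..d} \<longrightarrow> norm (g x) \<le> norm (f x)"
      using AE_not_in[OF N] by eventually_elim (use eq cd in fastforce)
    then show "set_integrable lebesgue {c..d} g"
      by (intro set_integrable_bound[OF L1_loc_integrable[OF f cd]]
          set_borel_measurable_lebesgue_subset[OF m _ cd]) auto
  qed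
qed

lemma oint_le_eq: "s \<le> t \<Longrightarrow> oint s t f = (LINT x:{s..t}|lebesgue. f x)"
proof -
  assume "s \<le> t"
  then have "oint s t f = (LINT x:{s<..<t}|lebesgue. f x)"
    by (simp add: oint_def interval_lebesgue_integral_def)
  also have "\<dots> = (LINT x:{s..t}|lebesgue. f x)"
    by (rule set_integral_discrete_difference[where X = "{s, t}"])
      (auto simp: emeasure_completion)
  finally show ?thesis .
qed

lemma oint_refl [simp]: "oint s s f = 0"
  by (simp add: oint_def interval_lebesgue_integral_def einterval_same set_lebesgue_integral_def)

lemma oint_swap: "oint t s f = - oint s t f"
  by (cases s t rule: linorder_cases) (auto simp: oint_def interval_lebesgue_integral_def)

lemma oint_ge_eq: "t \<le> s \<Longrightarrow> oint s t f = - (LINT x:{t..s}|lebesgue. f x)"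
  by (subst oint_swap) (simp add: oint_le_eq)

lemma oint_cong:
  assumes "\<And>x. x \<in> closed_segment s t \<Longrightarrow> f x = g x"
  shows "oint s t f = oint s t g"
proof -
  have *: "oint s t f = oint s t g" if "s \<le> t" "\<And>x. x \<in> closed_segment s t \<Longrightarrow> f x = g x" for s t
    using that by (auto simp: oint_le_eq closed_segment_eq_real_ivl intro!: set_lebesgue_integral_cong)
  show ?thesis
    using *[of s t] *[of t s] assms by (cases "s \<le> t") (auto simp: oint_swap[of t s] closed_segment_commute)
qed

context
  fixes a b :: ereal and s t :: real
  assumes st: "s \<in> einterval a b" "t \<in> einterval a b"
begin

lemma oint_add:
  "f \<in> L1_loc a b \<Longrightarrow> g \<in> L1_loc a b \<Longrightarrow> oint s t (\<lambda>x. f x + g x) = oint s t f + oint s t g"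
  using einterval_Icc_subset[OF st] einterval_Icc_subset[OF st(2,1)]
  by (cases "s \<le> t") (auto simp: oint_le_eq oint_ge_eq L1_loc_integrable)

lemma oint_diff:
  "f \<in> L1_loc a b \<Longrightarrow> g \<in> L1_loc a b \<Longrightarrow> oint s t (\<lambda>x. f x - g x) = oint s t f - oint s t g"
  using einterval_Icc_subset[OF st] einterval_Icc_subset[OF st(2,1)]
  by (cases "s \<le> t") (auto simp: oint_le_eq oint_ge_eq L1_loc_integrable)

lemma oint_bounded_linear:
  assumes T: "bounded_linear T" and f: "f \<in> L1_loc a b"
  shows "oint s t (\<lambda>x. T (f x)) = T (oint s t f)"
proof -
  interpret T: bounded_linear T by fact
  have *: "(LINT x:{c..d}|lebesgue. T (f x)) = T (LINT x:{c..d}|lebesgue. f x)" if "{c..d} \<subseteq> einterval a b" for c d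
    using integral_bounded_linear[OF T L1_loc_integrable[OF f that, unfolded set_integrable_def]]
    by (simp add: set_lebesgue_integral_def T.scaleR)
  show ?thesis
    using *[OF einterval_Icc_subset[OF st]] *[OF einterval_Icc_subset[OF st(2,1)]]
    by (cases "s \<le> t") (auto simp: oint_le_eq oint_ge_eq linear_neg[OF T.linear])
qed

lemma oint_cong_AE:
  fixes f g :: "real \<Rightarrow> 'a::{banach, second_countable_topology}"
  assumes f: "f \<in> L1_loc a b" and N: "N \<in> null_sets lebesgue"
    and eq: "\<And>x. x \<in> einterval a b - N \<Longrightarrow> f x = g x"
  shows "oint s t f = oint s t g"
proof -
  have g: "g \<in> L1_loc a b" using f N eq by (rule L1_loc_cong_AE)
  have *: "(LINT x:{c..d}|lebesgue. f x) = (LINT x:{c..d}|lebesgue. g x)" if cd: "{c..d} \<subseteq> einterval a b" for c d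
    unfolding set_lebesgue_integral_def
  proof (rule integral_cong_AE)
    show "(\<lambda>x. indicator {c..d} x *\<^sub>R f x) \<in> borel_measurable lebesgue"
      "(\<lambda>x. indicator {c..d} x *\<^sub>R g x) \<in> borel_measurable lebesgue"
      using L1_loc_integrable[OF f cd] L1_loc_integrable[OF g cd] by (auto simp: set_integrable_def)
    show "AE x in lebesgue. indicator {c..d} x *\<^sub>R f x = indicator {c..d} x *\<^sub>R g x"
      using AE_not_in[OF N] by eventually_elim (use eq cd in \<open>auto simp: indicator_def\<close>)
  qed
  show ?thesis
    using *[OF einterval_Icc_subset[OF st]] *[OF einterval_Icc_subset[OF st(2,1)]]
    by (cases "s \<le> t") (auto simp: oint_le_eq oint_ge_eq)
qed

lemma norm_oint_le:
  fixes f :: "real \<Rightarrow> 'a::{banach, second_countable_topology}"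
  assumes f: "f \<in> L1_loc a b" and g: "g \<in> L1_loc a b"
    and le: "\<And>x. x \<in> closed_segment s t \<Longrightarrow> norm (f x) \<le> g x"
  shows "norm (oint s t f) \<le> \<bar>oint s t g\<bar>"
proof -
  have *: "norm (LINT x:{c..d}|lebesgue. f x) \<le> (LINT x:{c..d}|lebesgue. g x)"
    if cd: "{c..d} \<subseteq> einterval a b" and le: "\<And>x. x \<in> {c..d} \<Longrightarrow> norm (f x) \<le> g x" for c d
    unfolding set_lebesgue_integral_def
    by (rule Bochner_Integration.integral_norm_bound_integral)
      (use L1_loc_integrable[OF f cd] L1_loc_integrable[OF g cd] le in \<open>auto simp: set_integrable_def indicator_def\<close>)
  show ?thesis
  proof (cases "s \<le> t")
    case True
    then have "norm (oint s t f) \<le> oint s t g"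
      using *[OF einterval_Icc_subset[OF st]] le by (simp add: oint_le_eq closed_segment_eq_real_ivl)
    then show ?thesis by simp
  next
    case False
    then have "norm (oint s t f) \<le> - oint s t g"
      using *[OF einterval_Icc_subset[OF st(2,1)]] le by (simp add: oint_ge_eq closed_segment_eq_real_ivl)
    then show ?thesis by simp
  qed
qed

lemma oint_nonneg:
  assumes "s \<le> t" "\<And>x. x \<in> {s..t} \<Longrightarrow> (0::real) \<le> g x"
  shows "0 \<le> oint s t g"
  using assms by (auto simp: oint_le_eq set_lebesgue_integral_def indicator_def intro!: integral_nonneg)

lemma oint_mono:
  fixes f g :: "real \<Rightarrow> real"
  assumes "s \<le> t" "f \<in> L1_loc a b" "g \<in> L1_loc a b" "\<And>x. x \<in> {s..t} \<Longrightarrow> f x \<le> g x"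
  shows "oint s t f \<le> oint s t g"
  using assms einterval_Icc_subset[OF st]
  by (auto simp: oint_le_eq intro!: set_integral_mono L1_loc_integrable)

end

lemma oint_const [simp]: "oint s t (\<lambda>_. c) = (t - s) *\<^sub>R c"
proof -
  have "oint s t (\<lambda>_. c) = (t - s) *\<^sub>R c" if "s \<le> t" for s t
    using that by (simp add: oint_le_eq set_integral_const fmeasurable_def emeasure_completion)
  from this[of s t] this[of t s] show ?thesis
    by (cases "s \<le> t") (auto simp: oint_swap[of t s] algebra_simps)
qed

lemma oint_cmult: "oint s t (\<lambda>x. c * f x) = c * oint s t f" for c :: real
  by (simp add: oint_def)

text \<open>
  For increasing endpoints this is additivity over adjacent intervals; the other five orderings
  of the endpoints reduce to it by reversing orientation.
\<close>

lemma oint_combine: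
  fixes f :: "real \<Rightarrow> 'a::{banach, second_countable_topology}"
  assumes f: "f \<in> L1_loc a b"
    and "r \<in> einterval a b" "s \<in> einterval a b" "t \<in> einterval a b"
  shows "oint r s f + oint s t f = oint r t f"
proof -
  have *: "oint r s f + oint s t f = oint r t f"
    if "r \<le> s" "s \<le> t" "r \<in> einterval a b" "s \<in> einterval a b" "t \<in> einterval a b" for r s t
  proof -
    have "(LINT x:{r..s} \<union> {s..t}|lebesgue. f x) = (LINT x:{r..s}|lebesgue. f x) + (LINT x:{s..t}|lebesgue. f x)"
    proof (rule set_integral_Un_AE)
      have "{s} \<in> null_sets lebesgue" by (auto simp: null_sets_def emeasure_completion)
      from AE_not_in[OF this] show "AE x in lebesgue. \<not> (x \<in> {r..s} \<and> x \<in> {s..t})"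
        by eventually_elim auto
    qed (use that in \<open>simp_all add: L1_loc_integrable[OF f] einterval_Icc_subset\<close>)
    moreover have "{r..s} \<union> {s..t} = {r..t}" using that by auto
    ultimately show ?thesis using that by (simp add: oint_le_eq)
  qed
  have sw: "oint t s f = - oint s t f" "oint s r f = - oint r s f" "oint t r f = - oint r t f"
    by (rule oint_swap)+
  have grp: "x + y = z" if "y = z + - x \<or> x = z + - y \<or> x = - (y + - z) \<or> y = - (- z + x) \<or> z = - (- y + - x)"
    for x y z :: 'a
    using that by (elim disjE) simp_all
  consider "r \<le> s" "s \<le> t" | "r \<le> t" "t \<le> s" | "s \<le> r" "r \<le> t" | "s \<le> t" "t \<le> r" | "t \<le> r" "r \<le> s" | "t \<le> s" "s \<le> r"
    by linarith
  then show ?thesis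
  proof cases
    case 1 then show ?thesis by (rule *) (use assms in auto)
  next
    case 2
    then have "oint r s f = oint r t f + - oint s t f" using *[of r t s] assms by (simp add: sw)
    then show ?thesis by (intro grp) simp
  next
    case 3
    then have "oint s t f = oint r t f + - oint r s f" using *[of s r t] assms by (simp add: sw)
    then show ?thesis by (intro grp) simp
  next
    case 4
    then have "oint r s f = - (oint s t f + - oint r t f)"
      using arg_cong[OF *[of s t r], of uminus] assms by (simp only: sw minus_minus)
    then show ?thesis by (intro grp) simp
  next
    case 5
    then have "oint s t f = - (- oint r t f + oint r s f)"
      using arg_cong[OF *[of t r s], of uminus] assms by (simp only: sw minus_minus)
    then show ?thesis by (intro grp) simp
  next
    case 6
    then have "oint r t f = - (- oint s t f + - oint r s f)"
      using arg_cong[OF *[of t s r], of uminus] assms by (simp only: sw minus_minus)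
    then show ?thesis by (intro grp) simp
  qed
qed

lemma oint_endpoint_diff:
  fixes f :: "real \<Rightarrow> 'a::{banach, second_countable_topology}"
  assumes f: "f \<in> L1_loc a b"
    and "r \<in> einterval a b" "s \<in> einterval a b" "t \<in> einterval a b"
  shows "oint r t f - oint r s f = oint s t f"
  unfolding oint_combine[OF assms, symmetric] by (rule add_diff_cancel_left')

text \<open>
  By the norm bound it is enough to treat \<open>\<parallel>f\<parallel>\<close>, for which continuity of the real-valued
  indefinite Henstock-Kurzweil integral applies.
\<close>

lemma continuous_on_oint:
  fixes f :: "real \<Rightarrow> 'a::{banach, second_countable_topology}"
  assumes f: "f \<in> L1_loc a b" and r: "r \<in> einterval a b"
  shows "continuous_on (einterval a b) (\<lambda>x. oint r x f)"
proof -
  have nf: "(\<lambda>x. norm (f x)) \<in> L1_loc a b" by (rule L1_loc_norm[OF f])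
  have "isCont (\<lambda>x. oint r x f) x" if x: "x \<in> einterval a b" for x
  proof -
    obtain e where e: "e > 0" "cball x e \<subseteq> einterval a b"
      using x open_contains_cball[of "einterval a b"] by auto
    let ?c = "x - e" and ?d = "x + e"
    have cd: "{?c..?d} \<subseteq> einterval a b" using e by (simp add: cball_eq_atLeastAtMost)
    then have cI: "?c \<in> einterval a b" using e by auto
    have eq: "integral {?c..y} (\<lambda>x. norm (f x)) = oint ?c y (\<lambda>x. norm (f x))" if "y \<in> {?c..?d}" for y
    proof -
      have "{?c..y} \<subseteq> einterval a b" using that cd by auto
      from set_lebesgue_integral_eq_integral(2)[OF L1_loc_integrable[OF nf this]] that
      show ?thesis by (simp add: oint_le_eq)
    qed
    have "continuous_on {?c..?d} (\<lambda>y. integral {?c..y} (\<lambda>x. norm (f x)))"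
      by (rule indefinite_integral_continuous_1)
        (rule set_lebesgue_integral_eq_integral(1)[OF L1_loc_integrable[OF nf cd]])
    then have "continuous_on {?c..?d} (\<lambda>y. oint ?c y (\<lambda>x. norm (f x)))"
      using eq by (subst (asm) continuous_on_cong[OF refl]) auto
    then have "isCont (\<lambda>y. oint ?c y (\<lambda>x. norm (f x))) x"
      using e by (intro continuous_on_interior) auto
    then have *: "((\<lambda>y. \<bar>oint ?c y (\<lambda>x. norm (f x)) - oint ?c x (\<lambda>x. norm (f x))\<bar>) \<longlongrightarrow> 0) (at x)"
      unfolding isCont_def by (metis LIM_zero tendsto_rabs_zero)
    have "((\<lambda>y. oint r y f - oint r x f) \<longlongrightarrow> 0) (at x)"
    proof (rule Lim_null_comparison[OF _ *])
      have "eventually (\<lambda>y. y \<in> einterval a b) (at x)"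
        using x by (intro eventually_at_in_open') auto
      then show "eventually (\<lambda>y. norm (oint r y f - oint r x f) \<le> \<bar>oint ?c y (\<lambda>x. norm (f x)) - oint ?c x (\<lambda>x. norm (f x))\<bar>) (at x)"
      proof eventually_elim
        case (elim y)
        have "oint r y f - oint r x f = oint x y f"
          by (rule oint_endpoint_diff[OF f r x elim])
        moreover have "oint ?c y (\<lambda>x. norm (f x)) - oint ?c x (\<lambda>x. norm (f x)) = oint x y (\<lambda>x. norm (f x))"
          by (rule oint_endpoint_diff[OF nf cI x elim])
        ultimately show ?case
          using norm_oint_le[OF x elim f nf] by simp
      qed
    qed
    then show ?thesis unfolding isCont_def by (simp add: LIM_zero_iff)
  qed
  then show ?thesis by (simp add: continuous_at_imp_continuous_on)
qed

lemma abs_oint_segment_mono: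
  fixes g :: "real \<Rightarrow> real"
  assumes g: "g \<in> L1_loc a b" and pos: "\<And>x. x \<in> einterval a b \<Longrightarrow> 0 \<le> g x"
    and x0: "x0 \<in> einterval a b" and x: "x \<in> einterval a b" and t: "t \<in> closed_segment x0 x"
  shows "\<bar>oint x0 t g\<bar> \<le> \<bar>oint x0 x g\<bar>"
proof -
  have tI: "t \<in> einterval a b" using einterval_segment_subset[OF x0 x] t by auto
  have nn: "0 \<le> oint r s g" if "r \<le> s" "r \<in> einterval a b" "s \<in> einterval a b" for r s
    by (rule oint_nonneg) (use that pos einterval_Icc_subset[OF that(2,3)] in auto)
  have c: "oint x0 t g + oint t x g = oint x0 x g" by (rule oint_combine[OF g x0 tI x])
  show ?thesis
  proof (cases "x0 \<le> x")
    case True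
    then have "x0 \<le> t" "t \<le> x" using t by (auto simp: closed_segment_eq_real_ivl)
    with nn x0 x tI have "0 \<le> oint x0 t g" "0 \<le> oint t x g" by auto
    with c show ?thesis by linarith
  next
    case False
    then have "t \<le> x0" "x \<le> t" using t by (auto simp: closed_segment_eq_real_ivl)
    with nn x0 x tI have "0 \<le> oint t x0 g" "0 \<le> oint x t g" by auto
    with c oint_swap[of t x0 g] oint_swap[of x t g] show ?thesis by linarith
  qed
qed

lemma abs_oint_eq_set_integral_segment:
  fixes g :: "real \<Rightarrow> real"
  assumes "\<And>t. 0 \<le> g t"
  shows "\<bar>oint s t g\<bar> = set_lebesgue_integral lebesgue (closed_segment s t) g"
proof -
  have nn: "0 \<le> (LINT r:{p..q}|lebesgue. g r)" for p q
    using assms by (auto simp: set_lebesgue_integral_def intro!: Bochner_Integration.integral_nonneg)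
  show ?thesis
    by (cases "s \<le> t") (simp_all add: oint_le_eq oint_ge_eq closed_segment_eq_real_ivl nn)
qed

section \<open>Gronwall's inequality with an integrable kernel\<close>

text \<open>
  With equality and \<open>1 / c\<close> in place of \<open>2 / c\<close> this would be the fundamental theorem of calculus for the
  absolutely continuous function \<open>exp (c W) / c\<close>. The spare factor \<open>2\<close> avoids differentiating \<open>W\<close>: on
  intervals so short that \<open>c W\<close> varies by at most \<open>ln 2\<close>, the factor \<open>exp (c W)\<close> is within a factor \<open>2\<close>
  of its minimum, and convexity of the exponential compares this minimum with the difference
  quotient. Both sides are additive, so the estimate for short intervals passes to all intervals.
\<close>

lemma oint_exp_weight:
  fixes w :: "real \<Rightarrow> real"
  assumes w: "w \<in> L1_loc a b" and pos: "\<And>x. x \<in> einterval a b \<Longrightarrow> 0 \<le> w x"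
    and x0: "x0 \<in> einterval a b" and c: "c \<noteq> 0"
    and st: "s \<le> t" "s \<in> einterval a b" "t \<in> einterval a b"
  defines "W \<equiv> \<lambda>x. oint x0 x w"
  shows "oint s t (\<lambda>r. w r * exp (c * W r)) \<le> 2 / c * (exp (c * W t) - exp (c * W s))"
proof -
  let ?I = "einterval a b"
  have contW: "continuous_on ?I W" unfolding W_def by (rule continuous_on_oint[OF w x0])
  then have int: "(\<lambda>r. w r * exp (c * W r)) \<in> L1_loc a b"
    by (intro L1_loc_times w continuous_intros)
  define P where "P s t \<longleftrightarrow> (s \<in> ?I \<and> t \<in> ?I \<and> s \<le> t \<longrightarrow>
    oint s t (\<lambda>r. w r * exp (c * W r)) \<le> 2 / c * (exp (c * W t) - exp (c * W s)))" for s t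
  have "P s t" using \<open>s \<le> t\<close>
  proof (induction rule: Bolzano)
    case (trans p q r)
    show ?case unfolding P_def
    proof (intro impI, elim conjE)
      assume I: "p \<in> ?I" "r \<in> ?I"
      then have q: "q \<in> ?I" using einterval_Icc_subset[OF I] trans by auto
      have "oint p r (\<lambda>r. w r * exp (c * W r)) = oint p q (\<lambda>r. w r * exp (c * W r)) + oint q r (\<lambda>r. w r * exp (c * W r))"
        by (rule oint_combine[OF int I(1) q I(2), symmetric])
      also have "\<dots> \<le> 2 / c * (exp (c * W q) - exp (c * W p)) + 2 / c * (exp (c * W r) - exp (c * W q))"
        using trans I q unfolding P_def by (intro add_mono) auto
      finally show "oint p r (\<lambda>r. w r * exp (c * W r)) \<le> 2 / c * (exp (c * W r) - exp (c * W p))"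
        by (simp add: algebra_simps)
    qed
  next
    case (local x)
    then have x: "x \<in> ?I" using einterval_Icc_subset[OF st(2,3)] by auto
    have "isCont W x" using contW x by (simp add: continuous_on_eq_continuous_at)
    then have "\<forall>e>0. \<exists>d>0. \<forall>y. dist y x < d \<longrightarrow> dist (W y) (W x) < e"
      by (simp add: continuous_at_eps_delta dist_real_def)
    moreover have "0 < ln 2 / (2 * \<bar>c\<bar>)" using c by simp
    ultimately obtain d where d: "d > 0" "\<And>y. dist y x < d \<Longrightarrow> dist (W y) (W x) < ln 2 / (2 * \<bar>c\<bar>)"
      by meson
    have "P p q" if pq: "p \<le> x" "x \<le> q" "q - p < d" for p q
      unfolding P_def
    proof (intro impI, elim conjE)
      assume I: "p \<in> ?I" "q \<in> ?I" and "p \<le> q"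
      have sub: "{p..q} \<subseteq> ?I" by (rule einterval_Icc_subset[OF I])
      have close: "\<bar>c * W r - c * W r'\<bar> \<le> ln 2" if "r \<in> {p..q}" "r' \<in> {p..q}" for r r'
      proof -
        have "dist r x < d" "dist r' x < d" using that pq by (auto simp: dist_real_def)
        from this[THEN d(2)] have "\<bar>W r - W r'\<bar> \<le> ln 2 / \<bar>c\<bar>" by (simp add: dist_real_def)
        then have "\<bar>c\<bar> * \<bar>W r - W r'\<bar> \<le> ln 2" using c by (simp add: pos_le_divide_eq mult.commute)
        then show ?thesis by (simp add: abs_mult[symmetric] right_diff_distrib)
      qed
      have dW: "W q - W p = oint p q w"
        unfolding W_def by (rule oint_endpoint_diff[OF w x0 I])
      have dpos: "0 \<le> oint p q w"
        by (rule oint_nonneg) (use \<open>p \<le> q\<close> pos sub in auto)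
      define m where "m = min (exp (c * W p)) (exp (c * W q))"
      have "oint p q (\<lambda>r. w r * exp (c * W r)) \<le> oint p q (\<lambda>r. 2 * m * w r)"
      proof (rule oint_mono[OF I \<open>p \<le> q\<close> int])
        show "(\<lambda>r. 2 * m * w r) \<in> L1_loc a b"
          using L1_loc_times[OF continuous_on_const w, of "2 * m"] by (simp add: mult.commute)
        fix r assume r: "r \<in> {p..q}"
        have "exp (c * W r) \<le> exp (ln 2 + c * W r')" if "r' \<in> {p..q}" for r'
          using close[OF r that] by simp
        then have "exp (c * W r) \<le> 2 * m"
          using \<open>p \<le> q\<close> unfolding m_def by (auto simp: exp_add min_def)
        then have "w r * exp (c * W r) \<le> w r * (2 * m)"
          using r sub pos by (intro mult_left_mono) auto
        then show "w r * exp (c * W r) \<le> 2 * m * w r" by (simp add: mult_ac)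
      qed
      also have "\<dots> = 2 * (m * (W q - W p))" by (simp add: oint_cmult dW)
      also have "m * (W q - W p) \<le> (exp (c * W q) - exp (c * W p)) / c"
      proof (cases "c > 0")
        case True
        have "exp (c * W p) * (1 + c * (W q - W p)) \<le> exp (c * W p) * exp (c * (W q - W p))"
          by (intro mult_left_mono exp_ge_add_one_self) auto
        then have le: "exp (c * W p) * (c * (W q - W p)) \<le> exp (c * W q) - exp (c * W p)"
          by (simp add: exp_add[symmetric] algebra_simps)
        have "m * (W q - W p) \<le> exp (c * W p) * (W q - W p)"
          using dW dpos by (intro mult_right_mono) (auto simp: m_def)
        then have "c * (m * (W q - W p)) \<le> c * (exp (c * W p) * (W q - W p))"
          using True by (intro mult_left_mono) auto
        also have "\<dots> \<le> exp (c * W q) - exp (c * W p)"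
          using le by (simp add: mult_ac)
        finally show ?thesis using True by (simp add: pos_le_divide_eq mult_ac)
      next
        case False
        then have c: "c < 0" using c by simp
        have "exp (c * W q) * (1 + c * (W p - W q)) \<le> exp (c * W q) * exp (c * (W p - W q))"
          by (intro mult_left_mono exp_ge_add_one_self) auto
        then have "exp (c * W q) * (c * (W p - W q)) \<le> exp (c * W p) - exp (c * W q)"
          by (simp add: exp_add[symmetric] algebra_simps)
        then have "exp (c * W q) * (W q - W p) \<le> (exp (c * W q) - exp (c * W p)) / c"
          unfolding neg_le_divide_eq[OF c] by (simp add: algebra_simps)
        moreover have "m * (W q - W p) \<le> exp (c * W q) * (W q - W p)"
          using dW dpos by (intro mult_right_mono) (auto simp: m_def)
        ultimately show ?thesis by linarith
      qed
      finally show "oint p q (\<lambda>r. w r * exp (c * W r)) \<le> 2 / c * (exp (c * W q) - exp (c * W p))"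
        by simp
    qed
    with d(1) show ?case by blast
  qed
  then show ?thesis using st by (simp add: P_def)
qed

text \<open>
  The exponent \<open>4\<close> is chosen so that the operator \<open>u \<mapsto> \<integral> w u\<close> has norm at most \<open>1 / 2\<close> for
  the weight \<open>exp (4 \<bar>W\<bar>)\<close>. To the left of \<open>x0\<close>, where \<open>W\<close> is negative, the preceding estimate is
  used with \<open>c = - 4\<close>.
\<close>

lemma oint_exp_abs_weight:
  fixes w :: "real \<Rightarrow> real"
  assumes w: "w \<in> L1_loc a b" and pos: "\<And>x. x \<in> einterval a b \<Longrightarrow> 0 \<le> w x"
    and x0: "x0 \<in> einterval a b" and x: "x \<in> einterval a b"
  shows "\<bar>oint x0 x (\<lambda>r. w r * exp (4 * \<bar>oint x0 r w\<bar>))\<bar> \<le> exp (4 * \<bar>oint x0 x w\<bar>) / 2"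
proof (cases "x0 \<le> x")
  case True
  have sub: "{x0..x} \<subseteq> einterval a b" by (rule einterval_Icc_subset[OF x0 x])
  have nn: "0 \<le> oint x0 r w" if "r \<in> {x0..x}" for r
    using that subsetD[OF sub] pos by (intro oint_nonneg) auto
  have eq: "oint x0 x (\<lambda>r. w r * exp (4 * \<bar>oint x0 r w\<bar>)) = oint x0 x (\<lambda>r. w r * exp (4 * oint x0 r w))"
    using True nn by (intro oint_cong) (auto simp: closed_segment_eq_real_ivl)
  have "0 \<le> oint x0 x (\<lambda>r. w r * exp (4 * oint x0 r w))"
    using True sub pos by (intro oint_nonneg) auto
  moreover have "oint x0 x (\<lambda>r. w r * exp (4 * oint x0 r w)) \<le> 2 / 4 * (exp (4 * oint x0 x w) - exp (4 * oint x0 x0 w))"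
    by (rule oint_exp_weight[OF w pos x0 _ True x0 x]) auto
  ultimately show ?thesis using nn[of x] True by (simp add: eq)
next
  case False
  then have le: "x \<le> x0" by simp
  have sub: "{x..x0} \<subseteq> einterval a b" by (rule einterval_Icc_subset[OF x x0])
  have nn: "oint x0 r w \<le> 0" if "r \<in> {x..x0}" for r
  proof -
    have "0 \<le> oint r x0 w" using that subsetD[OF sub] pos by (intro oint_nonneg) auto
    then show ?thesis using oint_swap[of r x0 w] by linarith
  qed
  have eq: "oint x0 x (\<lambda>r. w r * exp (4 * \<bar>oint x0 r w\<bar>)) = - oint x x0 (\<lambda>r. w r * exp (-4 * oint x0 r w))"
    unfolding oint_swap[of x0 x]
    using le nn by (intro arg_cong[where f = uminus] oint_cong) (auto simp: closed_segment_eq_real_ivl)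
  have "0 \<le> oint x x0 (\<lambda>r. w r * exp (-4 * oint x0 r w))"
    using le sub pos by (intro oint_nonneg) auto
  moreover have "oint x x0 (\<lambda>r. w r * exp (-4 * oint x0 r w)) \<le> 2 / (-4) * (exp (-4 * oint x0 x0 w) - exp (-4 * oint x0 x w))"
    by (rule oint_exp_weight[OF w pos x0 _ le x x0]) auto
  moreover have "\<bar>oint x0 x w\<bar> = - oint x0 x w" using nn[of x] le by simp
  ultimately show ?thesis by (simp add: eq) argo
qed

text \<open>
  At a maximum point of \<open>u / exp (4 \<bar>W\<bar>)\<close> on the segment, half of the maximum \<open>S\<close> is absorbed by
  the contraction property of the weight, which leaves \<open>S \<le> 2 c\<close>.
\<close>

lemma gronwall:
  fixes w u :: "real \<Rightarrow> real"
  assumes w: "w \<in> L1_loc a b" and pos: "\<And>x. x \<in> einterval a b \<Longrightarrow> 0 \<le> w x"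
    and x0: "x0 \<in> einterval a b" and x: "x \<in> einterval a b"
    and u: "continuous_on (einterval a b) u" "\<And>t. 0 \<le> u t" and c: "0 \<le> c"
    and le: "\<And>t. t \<in> closed_segment x0 x \<Longrightarrow> u t \<le> c + \<bar>oint x0 t (\<lambda>r. w r * u r)\<bar>"
  shows "u x \<le> 2 * c * exp (4 * \<bar>oint x0 x w\<bar>)"
proof -
  let ?I = "einterval a b" and ?J = "closed_segment x0 x"
  define q where "q t = exp (4 * \<bar>oint x0 t w\<bar>)" for t
  have q: "q t > 0" "q t \<ge> 1" for t by (auto simp: q_def)
  have cq: "continuous_on ?I q"
    unfolding q_def by (intro continuous_intros continuous_on_oint[OF w x0])
  have J: "?J \<subseteq> ?I" by (rule einterval_segment_subset[OF x0 x])
  have "continuous_on ?J (\<lambda>t. u t / q t)"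
    by (rule continuous_on_subset[OF _ J], intro continuous_intros u(1) cq) (use q(1) in \<open>auto simp: less_imp_neq[symmetric]\<close>)
  then obtain m where m: "m \<in> ?J" "\<And>t. t \<in> ?J \<Longrightarrow> u t / q t \<le> u m / q m"
    using continuous_attains_sup[of ?J "\<lambda>t. u t / q t"] by auto
  define S where "S = u m / q m"
  have S: "u t \<le> S * q t" if "t \<in> ?J" for t
    using m(2)[OF that] q(1)[of t] by (simp add: S_def pos_divide_le_eq)
  have S0: "0 \<le> S" using u(2) q(1)[of m] by (auto simp: S_def)
  have mI: "m \<in> ?I" using m J by auto
  have sub: "closed_segment x0 m \<subseteq> ?J" using m by (simp add: subset_closed_segment)
  have "\<bar>oint x0 m (\<lambda>r. w r * u r)\<bar> \<le> \<bar>oint x0 m (\<lambda>r. S * (w r * q r))\<bar>"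
    unfolding real_norm_def[symmetric]
  proof (rule norm_oint_le[OF x0 mI, of "\<lambda>r. w r * u r" "\<lambda>r. S * (w r * q r)", unfolded real_norm_def[symmetric]])
    show "(\<lambda>r. w r * u r) \<in> L1_loc a b" by (intro L1_loc_times w u)
    show "(\<lambda>r. S * (w r * q r)) \<in> L1_loc a b"
      using L1_loc_times[OF continuous_on_mult[OF continuous_on_const cq] w, of S] by (simp add: mult_ac)
    fix r assume r: "r \<in> closed_segment x0 m"
    then have "r \<in> ?J" "r \<in> ?I" using sub J by auto
    then have "w r * u r \<le> w r * (S * q r)" using S pos by (intro mult_left_mono) auto
    then show "norm (w r * u r) \<le> S * (w r * q r)" using pos[OF \<open>r \<in> ?I\<close>] u(2)[of r] by (simp add: mult_ac)
  qed
  also have "\<dots> = S * \<bar>oint x0 m (\<lambda>r. w r * q r)\<bar>" using S0 by (simp add: oint_cmult abs_mult)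
  also have "\<dots> \<le> S * (q m / 2)"
    unfolding q_def by (intro mult_left_mono S0 oint_exp_abs_weight[OF w pos x0 mI])
  finally have "u m \<le> c + S * q m / 2" using le[OF m(1)] by simp
  moreover have "u m = S * q m" using q(1)[of m] by (simp add: S_def)
  ultimately have "S * q m \<le> 2 * c" by simp
  moreover have "S \<le> S * q m" using S0 q(2)[of m] by (simp add: mult_left_mono[of 1 "q m" S, simplified])
  ultimately have "S \<le> 2 * c" by simp
  then have "S * q x \<le> 2 * c * q x" using q(1)[of x] by (intro mult_right_mono) auto
  with S[of x] have "u x \<le> 2 * c * q x" by simp
  then show ?thesis by (simp only: q_def)
qed

section \<open>Differential equations of Caratheodory type with a Lipschitz right-hand side\<close>

text \<open>
  Approximate \<open>Y\<close> by simple functions: for these the composition is glued from countably many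
  measurable pieces, and continuity of \<open>G t\<close> lets the approximations converge.
\<close>

lemma caratheodory_measurable:
  fixes G :: "'s \<Rightarrow> 'a::{metric_space, second_countable_topology} \<Rightarrow> 'b::metric_space"
  assumes meas: "\<And>v. (\<lambda>t. G t v) \<in> borel_measurable M"
    and cont: "\<And>t. t \<in> space M \<Longrightarrow> continuous_on UNIV (G t)"
    and Y: "Y \<in> borel_measurable M"
  shows "(\<lambda>t. G t (Y t)) \<in> borel_measurable M"
proof -
  obtain F where F: "\<And>i. simple_function M (F i)" "\<And>x. x \<in> space M \<Longrightarrow> (\<lambda>i. F i x) \<longlonglongrightarrow> Y x"
    using borel_measurable_implies_sequence_metric[OF Y] by blast
  show ?thesis
  proof (rule borel_measurable_LIMSEQ_metric)
    fix i
    have 1: "F i \<in> measurable M (count_space (F i ` space M))"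
      using F(1)[of i] by (auto simp: simple_function_def measurable_count_space_eq2)
    have 2: "countable (F i ` space M)"
      using F(1)[of i] by (simp add: simple_function_def countable_finite)
    show "(\<lambda>t. G t (F i t)) \<in> borel_measurable M"
      by (rule measurable_compose_countable'[where f = "\<lambda>v t. G t v", OF meas 1 2])
  next
    fix t assume t: "t \<in> space M"
    show "(\<lambda>i. G t (F i t)) \<longlonglongrightarrow> G t (Y t)"
      by (rule continuous_on_tendsto_compose[OF cont[OF t] F(2)[OF t]]) auto
  qed
qed

definition caratheodory_lipschitz ::
  "ereal \<Rightarrow> ereal \<Rightarrow> (real \<Rightarrow> real) \<Rightarrow> (real \<Rightarrow> 'a \<Rightarrow> 'a::{banach, second_countable_topology}) \<Rightarrow> bool" where
  "caratheodory_lipschitz a b w G \<longleftrightarrow>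
     w \<in> L1_loc a b \<and> (\<forall>t \<in> einterval a b. 0 \<le> w t) \<and> (\<forall>v. (\<lambda>t. G t v) \<in> L1_loc a b) \<and>
     (\<forall>t \<in> einterval a b. \<forall>u v. norm (G t u - G t v) \<le> w t * norm (u - v))"

context
  fixes a b :: ereal and w :: "real \<Rightarrow> real" and x0 :: real
    and G :: "real \<Rightarrow> 'a \<Rightarrow> 'a::{banach, second_countable_topology}"
  assumes G: "caratheodory_lipschitz a b w G" and x0: "x0 \<in> einterval a b"
begin

lemma caratheodory_weight: "w \<in> L1_loc a b" "t \<in> einterval a b \<Longrightarrow> 0 \<le> w t"
  using G by (auto simp: caratheodory_lipschitz_def)

lemma caratheodory_compose_L1_loc:
  assumes Y: "continuous_on (einterval a b) Y"
  shows "(\<lambda>t. G t (Y t)) \<in> L1_loc a b"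
proof -
  have lip: "norm (G t u - G t v) \<le> w t * norm (u - v)" if "t \<in> einterval a b" for t u v
    using G that by (auto simp: caratheodory_lipschitz_def)
  have GL: "(\<lambda>t. G t v) \<in> L1_loc a b" for v using G by (auto simp: caratheodory_lipschitz_def)
  have bound: "(\<lambda>t. norm (G t 0) + w t * norm (Y t)) \<in> L1_loc a b"
    by (intro L1_loc_add L1_loc_norm GL L1_loc_times continuous_intros Y caratheodory_weight)
  have meas: "(\<lambda>t. G t (Y t)) \<in> borel_measurable (lebesgue_on (einterval a b))"
  proof (rule caratheodory_measurable[where G = G and Y = Y])
    fix t assume "t \<in> space (lebesgue_on (einterval a b))"
    then have "t \<in> einterval a b" by simp
    then have "(w t)-lipschitz_on UNIV (G t)"
      using lip caratheodory_weight(2) by (auto simp: lipschitz_on_def dist_norm)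
    then show "continuous_on UNIV (G t)" by (rule lipschitz_on_continuous_on)
  qed (auto intro: L1_loc_measurable GL continuous_on_measurable_einterval Y)
  show ?thesis
  proof (rule L1_loc_bound[OF bound meas])
    fix t assume t: "t \<in> einterval a b"
    have "norm (G t (Y t)) \<le> norm (G t 0) + norm (G t (Y t) - G t 0)"
      using norm_triangle_sub[of "G t (Y t)" "G t 0"] by simp
    also have "\<dots> \<le> norm (G t 0) + w t * norm (Y t)" using lip[OF t, of "Y t" 0] by simp
    finally show "norm (G t (Y t)) \<le> norm (norm (G t 0) + w t * norm (Y t))" by simp
  qed
qed

text \<open>
  \<open>P\<close> is an approximate solution with defect \<open>g t - G t (P t)\<close>. Allowing a defect makes this one
  estimate serve for uniqueness, for continuous dependence on the data, and for differentiability
  in a parameter.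
\<close>

lemma caratheodory_perturbation:
  assumes Y: "continuous_on (einterval a b) Y"
      "\<And>x. x \<in> einterval a b \<Longrightarrow> Y x = Y0 + oint x0 x (\<lambda>t. G t (Y t))"
    and g: "g \<in> L1_loc a b"
      "\<And>x. x \<in> einterval a b \<Longrightarrow> P x = P0 + oint x0 x g"
    and x: "x \<in> einterval a b"
  shows "norm (Y x - P x) \<le>
    2 * (norm (Y0 - P0) + \<bar>oint x0 x (\<lambda>t. norm (g t - G t (P t)))\<bar>) * exp (4 * \<bar>oint x0 x w\<bar>)"
proof -
  let ?I = "einterval a b"
  have lip: "norm (G t u - G t v) \<le> w t * norm (u - v)" if "t \<in> ?I" for t u v
    using G that by (auto simp: caratheodory_lipschitz_def)
  have P: "continuous_on ?I P"
    by (subst continuous_on_cong[OF refl g(2)]) (auto intro!: continuous_intros continuous_on_oint[OF g(1) x0])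
  let ?d = "\<lambda>t. norm (g t - G t (P t))"
  have d: "?d \<in> L1_loc a b"
    by (intro L1_loc_norm L1_loc_diff g caratheodory_compose_L1_loc P)
  have wu: "(\<lambda>t. w t * norm (Y t - P t)) \<in> L1_loc a b"
    by (intro L1_loc_times continuous_intros Y(1) P caratheodory_weight)
  show ?thesis
  proof (rule gronwall[OF caratheodory_weight x0 x, where u = "\<lambda>t. norm (Y t - P t)"])
    show "continuous_on ?I (\<lambda>t. norm (Y t - P t))" by (intro continuous_intros Y(1) P)
    fix t assume tJ: "t \<in> closed_segment x0 x"
    then have t: "t \<in> ?I" using einterval_segment_subset[OF x0 x] by auto
    have "Y t - P t = (Y0 - P0) + oint x0 t (\<lambda>t. G t (Y t) - g t)"
      using oint_diff[OF x0 t caratheodory_compose_L1_loc[OF Y(1)] g(1)] Y(2)[OF t] g(2)[OF t] by simp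
    then have "norm (Y t - P t) \<le> norm (Y0 - P0) + norm (oint x0 t (\<lambda>t. G t (Y t) - g t))"
      using norm_triangle_ineq by metis
    also have "norm (oint x0 t (\<lambda>t. G t (Y t) - g t)) \<le> \<bar>oint x0 t (\<lambda>t. ?d t + w t * norm (Y t - P t))\<bar>"
    proof (rule norm_oint_le[OF x0 t])
      show "(\<lambda>t. G t (Y t) - g t) \<in> L1_loc a b"
        by (intro L1_loc_diff g caratheodory_compose_L1_loc Y)
      fix r assume "r \<in> closed_segment x0 t"
      then have r: "r \<in> ?I" using einterval_segment_subset[OF x0 t] by auto
      have "norm (G r (Y r) - g r) \<le> norm (G r (P r) - g r) + norm (G r (Y r) - G r (P r))"
        using norm_triangle_ineq[of "G r (P r) - g r" "G r (Y r) - G r (P r)"] by (simp add: algebra_simps)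
      also have "\<dots> \<le> ?d r + w r * norm (Y r - P r)"
        using lip[OF r] by (simp add: norm_minus_commute)
      finally show "norm (G r (Y r) - g r) \<le> ?d r + w r * norm (Y r - P r)" .
    qed (intro L1_loc_add d wu)
    also have "\<dots> \<le> \<bar>oint x0 t ?d\<bar> + \<bar>oint x0 t (\<lambda>t. w t * norm (Y t - P t))\<bar>"
      by (simp add: oint_add[OF x0 t d wu])
    also have "\<bar>oint x0 t ?d\<bar> \<le> \<bar>oint x0 x ?d\<bar>"
      by (rule abs_oint_segment_mono[OF d _ x0 x tJ]) simp
    finally show "norm (Y t - P t) \<le> norm (Y0 - P0) + \<bar>oint x0 x ?d\<bar> + \<bar>oint x0 t (\<lambda>t. w t * norm (Y t - P t))\<bar>"
      by simp
  qed auto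
qed

end

text \<open>
  The explicit rate makes the convergence of the Picard iterates uniform on compact intervals.
\<close>

lemma geometric_convergence:
  fixes s :: "nat \<Rightarrow> 'a::complete_space"
  assumes step: "\<And>n. dist (s (Suc n)) (s n) \<le> C * (1/2)^n"
  obtains l where "s \<longlonglongrightarrow> l" "\<And>n. dist l (s n) \<le> 2 * C * (1/2)^n"
proof -
  have C: "0 \<le> C" using step[of 0] by (simp add: order_trans[OF zero_le_dist])
  have tail: "dist (s (n + k)) (s n) \<le> 2 * C * (1/2)^n * (1 - (1/2)^k)" for n k
  proof (induction k)
    case (Suc k)
    have "dist (s (n + Suc k)) (s n) \<le> dist (s (Suc (n + k))) (s (n + k)) + dist (s (n + k)) (s n)"
      using dist_triangle[of "s (Suc (n + k))" "s n" "s (n + k)"] by simp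
    also have "\<dots> \<le> C * (1/2)^(n + k) + 2 * C * (1/2)^n * (1 - (1/2)^k)"
      by (intro add_mono step Suc.IH)
    also have "\<dots> = 2 * C * (1/2)^n * (1 - (1/2)^Suc k)" by (simp add: power_add algebra_simps)
    finally show ?case .
  qed simp
  have tail': "dist (s (n + k)) (s n) \<le> 2 * C * (1/2)^n" for n k
  proof -
    have "2 * C * (1/2)^n * (1 - (1/2)^k) \<le> 2 * C * (1/2)^n * 1"
      using C by (intro mult_left_mono) auto
    with tail[of n k] show ?thesis by simp
  qed
  have "(\<lambda>n. 2 * C * (1/2::real)^n) \<longlonglongrightarrow> 2 * C * 0"
    by (intro tendsto_intros LIMSEQ_power_zero) auto
  then have lim0: "(\<lambda>n. 2 * C * (1/2::real)^n) \<longlonglongrightarrow> 0" by simp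
  have "Cauchy s"
  proof (rule metric_CauchyI)
    fix e :: real assume "e > 0"
    then obtain N where "2 * C * (1/2)^N < e / 2"
      using order_tendstoD(2)[OF lim0, of "e / 2"] by (auto simp: eventually_sequentially)
    then have N: "dist (s n) (s N) < e / 2" if "n \<ge> N" for n
      using tail'[of N "n - N"] that by simp
    have "dist (s m) (s n) < e" if "m \<ge> N" "n \<ge> N" for m n
      using N[OF that(1)] N[OF that(2)] dist_triangle2[of "s m" "s n" "s N"] by simp
    then show "\<exists>M. \<forall>m\<ge>M. \<forall>n\<ge>M. dist (s m) (s n) < e" by blast
  qed
  then obtain l where l: "s \<longlonglongrightarrow> l" by (auto simp: Cauchy_convergent_iff convergent_def)
  show thesis
  proof (rule that[OF l])
    fix n
    have "(\<lambda>k. dist (s (n + k)) (s n)) \<longlonglongrightarrow> dist l (s n)"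
      using LIMSEQ_ignore_initial_segment[OF l, of n] by (intro tendsto_intros) (simp add: add.commute)
    then show "dist l (s n) \<le> 2 * C * (1/2)^n"
      by (rule LIMSEQ_le_const2) (use tail' in auto)
  qed
qed

text \<open>
  The Picard iterates are shown to satisfy \<open>\<parallel>p\<^bsub>n+1\<^esub> - p\<^sub>n\<parallel> \<le> B (1/2)\<^sup>n exp (4 \<bar>W\<bar>)\<close> on each
  segment from \<open>x0\<close>. The weight permits working on the whole interval at once; no continuation of
  local solutions is required.
\<close>

lemma caratheodory_existence:
  fixes G :: "real \<Rightarrow> 'a \<Rightarrow> 'a::{banach, second_countable_topology}"
  assumes G: "caratheodory_lipschitz a b w G" and x0: "x0 \<in> einterval a b"
  obtains Y where "continuous_on (einterval a b) Y"
    "\<And>x. x \<in> einterval a b \<Longrightarrow> Y x = Y0 + oint x0 x (\<lambda>t. G t (Y t))"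
proof -
  let ?I = "einterval a b"
  note w = caratheodory_weight(1)[OF G x0] and pos = caratheodory_weight(2)[OF G x0]
  note compose = caratheodory_compose_L1_loc[OF G x0]
  have lip: "norm (G t u - G t v) \<le> w t * norm (u - v)" if "t \<in> ?I" for t u v
    using G that by (auto simp: caratheodory_lipschitz_def)
  define p where "p = rec_nat (\<lambda>_. Y0) (\<lambda>n y x. Y0 + oint x0 x (\<lambda>t. G t (y t)))"
  have p0: "p 0 = (\<lambda>_. Y0)" and pS: "p (Suc n) x = Y0 + oint x0 x (\<lambda>t. G t (p n t))" for n x
    by (simp_all add: p_def)
  have cont: "continuous_on ?I (p n)" for n
  proof (induction n)
    case (Suc n)
    then show ?case
      by (simp add: pS[abs_def] continuous_on_add continuous_on_oint[OF compose x0])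
  qed (simp add: p0)
  have pI: "(\<lambda>t. G t (p n t)) \<in> L1_loc a b" for n by (rule compose[OF cont])
  define q where "q t = exp (4 * \<bar>oint x0 t w\<bar>)" for t
  have q: "q t \<ge> 1" for t by (simp add: q_def)
  have cq: "continuous_on ?I q"
    unfolding q_def by (intro continuous_intros continuous_on_oint[OF w x0])
  have n0: "(\<lambda>t. norm (G t Y0)) \<in> L1_loc a b"
    using pI[of 0] by (simp add: p0 L1_loc_norm)
  define B where "B x = \<bar>oint x0 x (\<lambda>t. norm (G t Y0))\<bar>" for x
  have contract: "\<bar>oint x0 t (\<lambda>r. w r * (K * q r))\<bar> \<le> K * q t / 2" if "0 \<le> K" "t \<in> ?I" for K t
  proof -
    have "\<bar>oint x0 t (\<lambda>r. w r * (K * q r))\<bar> = K * \<bar>oint x0 t (\<lambda>r. w r * q r)\<bar>"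
      using oint_cmult[of x0 t K "\<lambda>r. w r * q r"] that(1) by (simp add: mult_ac abs_mult)
    also have "\<dots> \<le> K * (q t / 2)"
      unfolding q_def by (intro mult_left_mono that oint_exp_abs_weight[OF w pos x0])
    finally show ?thesis by simp
  qed
  have wq: "(\<lambda>r. w r * (K * q r)) \<in> L1_loc a b" for K
    by (intro L1_loc_times w continuous_intros cq)
  have step: "norm (p (Suc n) t - p n t) \<le> B x * (1/2)^n * q t"
    if x: "x \<in> ?I" and t: "t \<in> closed_segment x0 x" for x t n
    using t
  proof (induction n arbitrary: t)
    case 0
    then have tI: "t \<in> ?I" using einterval_segment_subset[OF x0 x] by auto
    have "norm (p (Suc 0) t - p 0 t) \<le> \<bar>oint x0 t (\<lambda>t. norm (G t Y0))\<bar>"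
      using norm_oint_le[OF x0 tI _ n0, of "\<lambda>t. G t Y0"] pI[of 0] by (simp add: pS p0)
    also have "\<dots> \<le> B x"
      unfolding B_def by (rule abs_oint_segment_mono[OF n0 _ x0 x 0]) simp
    also have "\<dots> \<le> B x * q t" using q[of t] by (simp add: B_def mult_le_cancel_left1)
    finally show ?case by simp
  next
    case (Suc n)
    then have tI: "t \<in> ?I" using einterval_segment_subset[OF x0 x] by auto
    have "p (Suc (Suc n)) t - p (Suc n) t = oint x0 t (\<lambda>r. G r (p (Suc n) r) - G r (p n r))"
      by (simp only: pS[of "Suc n"] pS[of n t] oint_diff[OF x0 tI pI pI]) simp
    also have "norm \<dots> \<le> \<bar>oint x0 t (\<lambda>r. w r * (B x * (1/2)^n * q r))\<bar>"
    proof (rule norm_oint_le[OF x0 tI L1_loc_diff[OF pI pI] wq])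
      fix r assume r: "r \<in> closed_segment x0 t"
      then have rJ: "r \<in> closed_segment x0 x" using Suc.prems subset_closed_segment[of x0 t x0 x] by auto
      then have rI: "r \<in> ?I" using einterval_segment_subset[OF x0 x] by auto
      have "norm (G r (p (Suc n) r) - G r (p n r)) \<le> w r * norm (p (Suc n) r - p n r)" by (rule lip[OF rI])
      also have "\<dots> \<le> w r * (B x * (1/2)^n * q r)"
        by (intro mult_left_mono Suc.IH rJ pos rI)
      finally show "norm (G r (p (Suc n) r) - G r (p n r)) \<le> w r * (B x * (1/2)^n * q r)" .
    qed
    also have "\<dots> \<le> B x * (1/2)^n * q t / 2" by (rule contract[OF _ tI]) (simp add: B_def)
    finally show ?case by simp
  qed
  have "\<exists>l. (\<lambda>n. p n x) \<longlonglongrightarrow> l" if "x \<in> ?I" for x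
    by (rule geometric_convergence[of "\<lambda>n. p n x" "B x * q x"])
      (use step[OF that, of x] in \<open>auto simp: dist_norm mult_ac\<close>)
  then obtain Y where Y: "\<And>x. x \<in> ?I \<Longrightarrow> (\<lambda>n. p n x) \<longlonglongrightarrow> Y x" by metis
  have rate: "norm (Y t - p n t) \<le> 2 * B x * (1/2)^n * q t"
    if x: "x \<in> ?I" and t: "t \<in> closed_segment x0 x" for x t n
  proof -
    have tI: "t \<in> ?I" using t einterval_segment_subset[OF x0 x] by auto
    obtain l where l: "(\<lambda>n. p n t) \<longlonglongrightarrow> l" "\<And>n. dist l (p n t) \<le> 2 * (B x * q t) * (1/2)^n"
      by (rule geometric_convergence[of "\<lambda>n. p n t" "B x * q t"])
        (use step[OF x t] in \<open>auto simp: dist_norm mult_ac\<close>)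
    have "l = Y t" by (rule LIMSEQ_unique[OF l(1) Y[OF tI]])
    with l(2)[of n] show ?thesis by (simp add: dist_norm mult_ac)
  qed
  have uniform: "(\<lambda>n. 2 * B x * (1/2)^n * K) \<longlonglongrightarrow> 0" for x K
  proof -
    have "(\<lambda>n. 2 * B x * (1/2)^n * K) \<longlonglongrightarrow> 2 * B x * 0 * K"
      by (intro tendsto_intros LIMSEQ_power_zero) auto
    then show ?thesis by simp
  qed
  \<comment> \<open>The bound \<open>B\<close> depends on the endpoint, so the convergence is uniform on each segment from \<open>x0\<close>
    only; every point of the interval is interior to the union of two of them.\<close>
  have contY: "continuous_on ?I Y"
  proof -
    have J: "continuous_on (closed_segment x0 x) Y" if x: "x \<in> ?I" for x
    proof (rule uniform_limit_theorem[OF _ _ trivial_limit_sequentially])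
      have sub: "closed_segment x0 x \<subseteq> ?I" by (rule einterval_segment_subset[OF x0 x])
      then show "\<forall>\<^sub>F n in sequentially. continuous_on (closed_segment x0 x) (p n)"
        by (intro always_eventually allI continuous_on_subset[OF cont])
      have qle: "q t \<le> q x" if "t \<in> closed_segment x0 x" for t
        unfolding q_def using abs_oint_segment_mono[OF w pos x0 x that] by simp
      show "uniform_limit (closed_segment x0 x) p Y sequentially"
      proof (rule uniform_limitI)
        fix e :: real assume "e > 0"
        with order_tendstoD(2)[OF uniform[of x "q x"]] have "\<forall>\<^sub>F n in sequentially. 2 * B x * (1/2)^n * q x < e"
          by blast
        then show "\<forall>\<^sub>F n in sequentially. \<forall>t\<in>closed_segment x0 x. dist (p n t) (Y t) < e"
        proof eventually_elim
          case (elim n)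
          show ?case
          proof
            fix t assume t: "t \<in> closed_segment x0 x"
            have "dist (p n t) (Y t) \<le> 2 * B x * (1/2)^n * q t"
              using rate[OF x t] by (simp add: dist_norm norm_minus_commute)
            also have "\<dots> \<le> 2 * B x * (1/2)^n * q x"
              using qle[OF t] by (intro mult_left_mono) (auto simp: B_def)
            finally show "dist (p n t) (Y t) < e" using elim by simp
          qed
        qed
      qed
    qed
    have "isCont Y x" if x: "x \<in> ?I" for x
    proof -
      obtain e where e: "e > 0" "cball x e \<subseteq> ?I" using x open_contains_cball[of ?I] by auto
      then have I: "x - e \<in> ?I" "x + e \<in> ?I" by (auto simp: cball_eq_atLeastAtMost)
      have "continuous_on (closed_segment x0 (x - e) \<union> closed_segment x0 (x + e)) Y"
        by (intro continuous_on_closed_Un J I) auto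
      moreover have "{x - e..x + e} \<subseteq> closed_segment x0 (x - e) \<union> closed_segment x0 (x + e)"
        by (auto simp: closed_segment_eq_real_ivl)
      ultimately have "continuous_on {x - e..x + e} Y" by (rule continuous_on_subset)
      then show ?thesis using e by (intro continuous_on_interior) auto
    qed
    then show ?thesis by (simp add: continuous_at_imp_continuous_on)
  qed
  show thesis
  proof (rule that[OF contY])
    fix x assume x: "x \<in> ?I"
    have "(\<lambda>n. p (Suc n) x) \<longlonglongrightarrow> Y0 + oint x0 x (\<lambda>t. G t (Y t))"
    proof (rule LIM_zero_cancel, rule Lim_null_comparison[OF _ uniform[of x "q x"]], intro always_eventually allI)
      fix n
      have "p (Suc n) x - (Y0 + oint x0 x (\<lambda>t. G t (Y t))) = oint x0 x (\<lambda>r. G r (p n r) - G r (Y r))"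
        by (simp add: pS oint_diff[OF x0 x pI compose[OF contY]])
      also have "norm \<dots> \<le> \<bar>oint x0 x (\<lambda>r. w r * (2 * B x * (1/2)^n * q r))\<bar>"
      proof (rule norm_oint_le[OF x0 x L1_loc_diff[OF pI compose[OF contY]] wq])
        fix r assume r: "r \<in> closed_segment x0 x"
        then have rI: "r \<in> ?I" using einterval_segment_subset[OF x0 x] by auto
        have "norm (G r (p n r) - G r (Y r)) \<le> w r * norm (p n r - Y r)" by (rule lip[OF rI])
        also have "\<dots> \<le> w r * (2 * B x * (1/2)^n * q r)"
          using rate[OF x r, of n] by (intro mult_left_mono pos rI) (simp add: norm_minus_commute)
        finally show "norm (G r (p n r) - G r (Y r)) \<le> w r * (2 * B x * (1/2)^n * q r)" .
      qed
      also have "\<dots> \<le> 2 * B x * (1/2)^n * q x / 2" by (rule contract[OF _ x]) (simp add: B_def)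
      also have "\<dots> \<le> 2 * B x * (1/2)^n * q x" using q[of x] by (simp add: B_def)
      finally show "norm (p (Suc n) x - (Y0 + oint x0 x (\<lambda>t. G t (Y t)))) \<le> 2 * B x * (1/2)^n * q x" .
    qed
    moreover have "(\<lambda>n. p (Suc n) x) \<longlonglongrightarrow> Y x" by (rule LIMSEQ_Suc[OF Y[OF x]])
    ultimately show "Y x = Y0 + oint x0 x (\<lambda>t. G t (Y t))" by (rule LIMSEQ_unique[rotated])
  qed
qed

section \<open>Complex Hilbert spaces and weak measurability\<close>

lemma norm_scaleC [simp]: "norm (c *\<^sub>C u) = norm c * norm (u :: 'a::complex_hilbert_space)"
proof -
  have "complex_of_real ((norm (c *\<^sub>C u))\<^sup>2) = c * (cnj c * cinner u u)"
    by (metis cinner_commute cinner_scaleC_right cinner_self complex_cnj_complex_of_real complex_cnj_mult)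
  also have "\<dots> = complex_of_real ((norm c * norm u)\<^sup>2)"
    by (simp add: cinner_self mult.assoc[symmetric] complex_norm_square[symmetric] power_mult_distrib)
  finally have "(norm (c *\<^sub>C u))\<^sup>2 = (norm c * norm u)\<^sup>2"
    by (simp only: of_real_eq_iff)
  then show ?thesis by (simp add: power2_eq_imp_eq)
qed

lemma bounded_bilinear_scaleC:
  "bounded_bilinear (scaleC :: complex \<Rightarrow> 'a::complex_hilbert_space \<Rightarrow> 'a)"
proof
  fix r c and u :: 'a
  show "(r *\<^sub>R c) *\<^sub>C u = r *\<^sub>R (c *\<^sub>C u)"
    by (simp add: scaleR_scaleC scaleC_scaleC scaleR_conv_of_real)
  show "c *\<^sub>C (r *\<^sub>R u) = r *\<^sub>R (c *\<^sub>C u)"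
    by (simp add: scaleR_scaleC scaleC_scaleC mult.commute)
qed (auto simp: scaleC_add_left scaleC_add_right intro: exI[of _ 1])

interpretation scaleC: bounded_bilinear "scaleC :: complex \<Rightarrow> 'a::complex_hilbert_space \<Rightarrow> 'a"
  by (rule bounded_bilinear_scaleC)

text \<open>
  A first-order expansion with quadratic remainder near \<open>z\<close> gives the complex derivative in norm.
\<close>

lemma inverse_scaleC_tendsto:
  fixes g :: "complex \<Rightarrow> 'a::complex_hilbert_space"
  assumes bound: "\<And>w. cmod (w - z) \<le> 1 \<Longrightarrow> norm (g w - g z - (w - z) *\<^sub>C D) \<le> K * (cmod (w - z))\<^sup>2"
  shows "((\<lambda>w. inverse (w - z) *\<^sub>C (g w - g z)) \<longlongrightarrow> D) (at z)"
proof (rule LIM_zero_cancel, rule Lim_null_comparison)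
  have "((\<lambda>w. K * cmod (w - z)) \<longlongrightarrow> K * cmod (z - z)) (at z)" by (intro tendsto_intros)
  then show "((\<lambda>w. K * cmod (w - z)) \<longlongrightarrow> 0) (at z)" by simp
  have "eventually (\<lambda>w. w \<in> ball z 1) (at z)" by (rule eventually_at_in_open') auto
  moreover have "eventually (\<lambda>w. w \<noteq> z) (at z)" by (rule eventually_neq_at_within)
  ultimately show "eventually (\<lambda>w. norm (inverse (w - z) *\<^sub>C (g w - g z) - D) \<le> K * cmod (w - z)) (at z)"
  proof eventually_elim
    case (elim w)
    then have c: "w - z \<noteq> 0" "cmod (w - z) \<le> 1" by (auto simp: dist_norm norm_minus_commute)
    have one: "1 *\<^sub>C D = D" by (metis of_real_1 scaleR_one scaleR_scaleC)
    have "inverse (w - z) *\<^sub>C (g w - g z) - D = inverse (w - z) *\<^sub>C (g w - g z - (w - z) *\<^sub>C D)"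
      using c(1) one by (simp add: scaleC.diff_right scaleC_scaleC)
    also have "norm \<dots> \<le> inverse (cmod (w - z)) * (K * (cmod (w - z))\<^sup>2)"
      unfolding norm_scaleC norm_inverse by (intro mult_left_mono bound c) auto
    also have "\<dots> = K * cmod (w - z)" using c(1) by (simp add: power2_eq_square field_simps)
    finally show ?case .
  qed
qed

lemma Re_cinner_polarization:
  "Re (cinner u v) = ((norm (u + v))\<^sup>2 - (norm (u - v))\<^sup>2) / 4"
proof -
  have add_left: "cinner (x + y) z = cinner x z + cinner y z" for x y z :: 'a
    by (metis cinner_add_right cinner_commute complex_cnj_add)
  have sq: "(norm x)\<^sup>2 = Re (cinner x x)" for x :: 'a by (simp add: cinner_self)
  have sym: "Re (cinner x y) = Re (cinner y x)" for x y :: 'a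
    by (subst cinner_commute) simp
  have m: "-x = (-1) *\<^sub>C x" for x :: 'a
    by (metis scaleC.minus_left scaleR_one scaleR_scaleC of_real_1)
  have minus: "Re (cinner x (- y)) = - Re (cinner x y)" for x y :: 'a
    by (subst m) (simp add: cinner_scaleC_right)
  have plus: "(norm (x + y))\<^sup>2 = (norm x)\<^sup>2 + 2 * Re (cinner x y) + (norm y)\<^sup>2" for x y :: 'a
    using sym[of y x] by (simp add: sq add_left cinner_add_right)
  show ?thesis
    using plus[of u v] plus[of u "- v"] by (simp add: minus)
qed

text \<open>
  Polarization reduces the Cauchy-Schwarz inequality to the two triangle inequalities of the norm.
\<close>

lemma Re_cinner_le_norm: "Re (cinner u v) \<le> norm u * norm v"
proof -
  have "(norm (u + v))\<^sup>2 \<le> (norm u + norm v)\<^sup>2"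
    by (intro power_mono norm_triangle_ineq) auto
  moreover have "(norm u - norm v)\<^sup>2 \<le> (norm (u - v))\<^sup>2"
    using power_mono[OF norm_triangle_ineq3[of u v], of 2] by simp
  ultimately show ?thesis
    by (simp add: Re_cinner_polarization power2_eq_square algebra_simps)
qed

text \<open>
  A countable \<open>D\<close> turns this into a measurable characterization of \<open>\<parallel>w\<parallel> \<le> r\<close>. Density suffices
  because testing with \<open>u\<close> close to \<open>w\<close> nearly attains \<open>\<parallel>w\<parallel>\<^sup>2\<close>.
\<close>

lemma norm_le_iff_cinner_dense:
  fixes w :: "'a::complex_hilbert_space"
  assumes D: "\<And>u e. 0 < e \<Longrightarrow> \<exists>d\<in>D. dist d u < e" and r: "0 \<le> r"
  shows "norm w \<le> r \<longleftrightarrow> (\<forall>u\<in>D. Re (cinner u w) \<le> r * norm u)"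
proof
  assume "norm w \<le> r"
  then show "\<forall>u\<in>D. Re (cinner u w) \<le> r * norm u"
    using Re_cinner_le_norm[of _ w] by (metis mult.commute mult_left_mono norm_ge_zero order_trans)
next
  assume *: "\<forall>u\<in>D. Re (cinner u w) \<le> r * norm u"
  have "\<forall>n. \<exists>d\<in>D. dist d w < 1 / real (Suc n)" using D by auto
  then obtain s where s: "\<And>n. s n \<in> D" "\<And>n. dist (s n) w < 1 / real (Suc n)" by metis
  have "s \<longlonglongrightarrow> w"
  proof (rule metric_LIMSEQ_I)
    fix e :: real assume "0 < e"
    then obtain N where "1 / real (Suc N) < e" using nat_approx_posE by metis
    then have "dist (s n) w < e" if "n \<ge> N" for n
      using s(2)[of n] that frac_le[of 1 1 "real (Suc N)" "real (Suc n)"] by simp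
    then show "\<exists>N. \<forall>n\<ge>N. dist (s n) w < e" by blast
  qed
  then have "(\<lambda>n. Re (cinner (s n) w)) \<longlonglongrightarrow> Re (cinner w w)" "(\<lambda>n. r * norm (s n)) \<longlonglongrightarrow> r * norm w"
    unfolding Re_cinner_polarization by (intro tendsto_intros; simp)+
  then have "Re (cinner w w) \<le> r * norm w"
    by (rule LIMSEQ_le) (use * s(1) in blast)
  then have "norm w * norm w \<le> r * norm w" by (simp add: cinner_self power2_eq_square)
  then show "norm w \<le> r" using r by (cases "w = 0") auto
qed

text \<open>
  Preimages of balls are measurable because the distance to a fixed vector is determined by
  countably many inner products; countably many balls generate the Borel sets.
\<close>

lemma pettis_measurable:
  fixes g :: "'s \<Rightarrow> 'a::{complex_hilbert_space, second_countable_topology}"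
  assumes weak: "\<And>u. (\<lambda>t. cinner u (g t)) \<in> borel_measurable M"
  shows "g \<in> borel_measurable M"
proof -
  obtain D :: "'a set" where D: "countable D" "\<And>X. open X \<Longrightarrow> X \<noteq> {} \<Longrightarrow> \<exists>d\<in>D. d \<in> X"
    by (erule countable_dense_setE)
  have dense: "\<exists>d\<in>D. dist d u < e" if "0 < e" for u e
    using D(2)[of "ball u e"] that by (auto simp: dist_commute)
  have norm_meas: "(\<lambda>t. norm (g t - q)) \<in> borel_measurable M" for q
    unfolding borel_measurable_iff_le
  proof
    fix r
    have "Re (cinner u (g t - q)) = Re (cinner u (g t)) - Re (cinner u q)" for u t
      using arg_cong[OF cinner_add_right[of u "g t - q" q], of Re] by simp
    then have [measurable]: "(\<lambda>t. Re (cinner u (g t - q))) \<in> borel_measurable M" for u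
      using weak[of u] by simp
    show "{t \<in> space M. norm (g t - q) \<le> r} \<in> sets M"
    proof (cases "0 \<le> r")
      case True
      have "{t \<in> space M. norm (g t - q) \<le> r} = {t \<in> space M. \<forall>u\<in>D. Re (cinner u (g t - q)) \<le> r * norm u}"
        using norm_le_iff_cinner_dense[OF dense True] by simp
      also have "\<dots> \<in> sets M"
        using D(1) by measurable
      finally show ?thesis .
    next
      case False
      then have "{t \<in> space M. norm (g t - q) \<le> r} = {}"
        by (auto dest: order_trans[OF norm_ge_zero])
      then show ?thesis by (metis sets.empty_sets)
    qed
  qed
  obtain C :: "'a set" where C: "countable C" "topological_basis (case_prod ball ` (C \<times> (\<rat> \<inter> {0<..})))"
    using balls_countable_basis by metis
  let ?B = "case_prod ball ` (C \<times> (\<rat> \<inter> {0<..}))"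
  have "countable ?B" using C(1) countable_rat by (intro countable_image countable_SIGMA) auto
  then have borel: "borel = sigma UNIV ?B"
    using C(2) by (rule borel_eq_countable_basis)
  show ?thesis unfolding borel
  proof (rule measurable_measure_of)
    fix S assume "S \<in> ?B"
    then obtain q e where S: "S = ball q e" by auto
    have "g -` S \<inter> space M = {t \<in> space M. norm (g t - q) < e}"
      by (auto simp: S dist_norm norm_minus_commute)
    also have "\<dots> \<in> sets M" using norm_meas[of q] by measurable
    finally show "g -` S \<inter> space M \<in> sets M" .
  qed auto
qed

section \<open>Lebesgue points\<close>

text \<open>
  Since \<open>oint x t\<close> changes sign with the orientation, the absolute value makes the condition
  two-sided.
\<close>

definition lebesgue_point :: "(real \<Rightarrow> 'a::{banach, second_countable_topology}) \<Rightarrow> real \<Rightarrow> bool" where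
  "lebesgue_point f x \<longleftrightarrow>
    (\<forall>e>0. \<exists>d>0. \<forall>t. \<bar>t - x\<bar> < d \<longrightarrow> \<bar>oint x t (\<lambda>s. norm (f s - f x))\<bar> \<le> e * \<bar>t - x\<bar>)"

lemma einterval_ball:
  assumes "x \<in> einterval a b"
  obtains d where "0 < d" "\<And>t. \<bar>t - x\<bar> < d \<Longrightarrow> t \<in> einterval a b"
  using assms open_contains_ball[of "einterval a b"]
  by (auto simp: subset_iff dist_real_def abs_minus_commute)

lemma lebesgue_differentiation_right:
  fixes g :: "real \<Rightarrow> real"
  assumes "\<And>c d. g integrable_on {c..d}"
  obtains N where "negligible N"
    "\<And>x e. x \<notin> N \<Longrightarrow> 0 < e \<Longrightarrow>
       \<exists>d>0. \<forall>h. 0 < h \<and> h < d \<longrightarrow> \<bar>integral {x..x + h} g - h * g x\<bar> \<le> e * h"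
proof -
  have "g integrable_on cbox c d" for c d
    using assms by simp
  then obtain N where N: "negligible N"
    "\<And>x e. x \<notin> N \<Longrightarrow> 0 < e \<Longrightarrow>
      \<exists>d>0. \<forall>h. 0 < h \<and> h < d \<longrightarrow> norm (integral (cbox x (x + h *\<^sub>R One)) g /\<^sub>R h ^ DIM(real) - g x) < e"
    using integrable_ccontinuous_explicit[of g] by metis
  show thesis
  proof (rule that[OF N(1)])
    fix x e :: real assume "x \<notin> N" "0 < e"
    from N(2)[OF this] obtain d where d: "d > 0"
      "\<And>h. 0 < h \<Longrightarrow> h < d \<Longrightarrow> \<bar>integral {x..x + h} g / h - g x\<bar> < e"
      by (auto simp: divide_inverse mult.commute)
    have "\<bar>integral {x..x + h} g - h * g x\<bar> \<le> e * h" if "0 < h" "h < d" for h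
    proof -
      have "integral {x..x + h} g - h * g x = h * (integral {x..x + h} g / h - g x)"
        using that by (simp add: field_simps)
      also have "\<bar>\<dots>\<bar> \<le> h * e"
        unfolding abs_mult using d(2)[OF that] that by (intro mult_mono) auto
      finally show ?thesis by (simp add: mult.commute)
    qed
    with d(1) show "\<exists>d>0. \<forall>h. 0 < h \<and> h < d \<longrightarrow> \<bar>integral {x..x + h} g - h * g x\<bar> \<le> e * h" by blast
  qed
qed

text \<open>
  One-sided differentiation applies to functions integrable on the whole line. Cutting \<open>g\<close> off to
  one of countably many rational intervals produces such functions, and reflecting them supplies
  the derivative from the left.
\<close>

lemma lebesgue_differentiation_real:
  fixes g :: "real \<Rightarrow> real"
  assumes g: "g \<in> L1_loc a b"
  obtains N where "N \<in> null_sets lebesgue"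
    "\<And>x e. x \<in> einterval a b - N \<Longrightarrow> 0 < e \<Longrightarrow>
       \<exists>d>0. \<forall>t. \<bar>t - x\<bar> < d \<longrightarrow> \<bar>oint x t g - (t - x) * g x\<bar> \<le> e * \<bar>t - x\<bar>"
proof -
  let ?I = "einterval a b"
  have local: "\<exists>N. negligible N \<and> (\<forall>x\<in>{p<..<q} - N. \<forall>e>0.
      \<exists>d>0. \<forall>t. \<bar>t - x\<bar> < d \<longrightarrow> \<bar>oint x t g - (t - x) * g x\<bar> \<le> e * \<bar>t - x\<bar>)"
    if pq: "{p..q} \<subseteq> ?I" for p q
  proof -
    define h where "h x = (if x \<in> {p..q} then g x else 0)" for x
    have "g integrable_on {p..q}"
      by (rule set_lebesgue_integral_eq_integral(1)[OF L1_loc_integrable[OF g pq]])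
    then have "h integrable_on UNIV" unfolding h_def by (simp only: integrable_restrict_UNIV)
    then have int: "h integrable_on {c..d}" for c d
      using integrable_on_subcbox[of h UNIV c d] by simp
    have int': "(\<lambda>x. h (- x)) integrable_on {c..d}" for c d
      using int[of "- d" "- c"] Henstock_Kurzweil_Integration.integrable_reflect_real[where a = "- d" and b = "- c" and f = h] by simp
    obtain N1 where N1: "negligible N1" "\<And>x e. x \<notin> N1 \<Longrightarrow> 0 < e \<Longrightarrow>
       \<exists>d>0. \<forall>r. 0 < r \<and> r < d \<longrightarrow> \<bar>integral {x..x + r} h - r * h x\<bar> \<le> e * r"
      using lebesgue_differentiation_right[OF int] by metis
    obtain N2 where N2: "negligible N2" "\<And>x e. x \<notin> N2 \<Longrightarrow> 0 < e \<Longrightarrow>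
       \<exists>d>0. \<forall>r. 0 < r \<and> r < d \<longrightarrow> \<bar>integral {x..x + r} (\<lambda>x. h (- x)) - r * h (- x)\<bar> \<le> e * r"
      using lebesgue_differentiation_right[OF int'] by metis
    have "negligible (N1 \<union> uminus ` N2)"
      using N1(1) N2(1)
      by (intro negligible_Un negligible_differentiable_image_negligible)
        (auto intro!: derivative_intros)
    moreover have "\<exists>d>0. \<forall>t. \<bar>t - x\<bar> < d \<longrightarrow> \<bar>oint x t g - (t - x) * g x\<bar> \<le> e * \<bar>t - x\<bar>"
      if x: "x \<in> {p<..<q}" "x \<notin> N1 \<union> uminus ` N2" and e: "0 < e" for x e
    proof -
      have eq: "integral {s..t} h = oint s t g" if "s \<le> t" "p \<le> s" "t \<le> q" for s t
      proof -
        have sub: "{s..t} \<subseteq> ?I" using pq that by auto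
        have "integral {s..t} h = integral {s..t} g"
          using that by (intro integral_cong) (auto simp: h_def)
        also have "\<dots> = oint s t g"
          using set_lebesgue_integral_eq_integral(2)[OF L1_loc_integrable[OF g sub]] that by (simp add: oint_le_eq)
        finally show ?thesis .
      qed
      obtain d1 where d1: "d1 > 0" "\<And>r. 0 < r \<Longrightarrow> r < d1 \<Longrightarrow> \<bar>integral {x..x + r} h - r * h x\<bar> \<le> e * r"
        using N1(2)[of x e] x e by auto
      have "- x \<notin> N2" using x by force
      then obtain d2 where d2: "d2 > 0" "\<And>r. 0 < r \<Longrightarrow> r < d2 \<Longrightarrow>
          \<bar>integral {- x..- x + r} (\<lambda>x. h (- x)) - r * h x\<bar> \<le> e * r"
        using N2(2)[of "- x" e] e by auto
      define d where "d = min (min d1 d2) (min (x - p) (q - x))"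
      have "\<bar>oint x t g - (t - x) * g x\<bar> \<le> e * \<bar>t - x\<bar>" if t: "\<bar>t - x\<bar> < d" for t
      proof -
        consider "t = x" | "x < t" | "t < x" by linarith
        then show ?thesis
        proof cases
          case 2
          with t d1(2)[of "t - x"] x eq[of x t] show ?thesis by (auto simp: d_def h_def)
        next
          case 3
          have "integral {- x..- t} (\<lambda>x. h (- x)) = integral {t..x} h"
            by (rule Henstock_Kurzweil_Integration.integral_reflect_real)
          with t d2(2)[of "x - t"] x eq[of t x] 3 have "\<bar>oint t x g - (x - t) * g x\<bar> \<le> e * (x - t)"
            by (auto simp: d_def h_def)
          moreover have "oint x t g - (t - x) * g x = - (oint t x g - (x - t) * g x)"
            by (subst oint_swap) (simp add: algebra_simps)
          ultimately show ?thesis using 3 by simp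
        qed simp
      qed
      moreover have "d > 0" using d1 d2 x by (auto simp: d_def)
      ultimately show ?thesis by blast
    qed
    ultimately show ?thesis by blast
  qed
  define Q where "Q = {(p, q). p \<in> \<rat> \<and> q \<in> \<rat> \<and> {p..q} \<subseteq> ?I}"
  have cQ: "countable Q"
    by (rule countable_subset[of _ "\<rat> \<times> \<rat>"]) (auto simp: Q_def countable_rat)
  have "\<forall>pq\<in>Q. \<exists>N. negligible N \<and> (\<forall>x\<in>{fst pq<..<snd pq} - N. \<forall>e>0.
      \<exists>d>0. \<forall>t. \<bar>t - x\<bar> < d \<longrightarrow> \<bar>oint x t g - (t - x) * g x\<bar> \<le> e * \<bar>t - x\<bar>)"
    using local by (auto simp: Q_def)
  then obtain N where N: "\<And>pq. pq \<in> Q \<Longrightarrow> negligible (N pq)"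
    "\<And>pq x e. pq \<in> Q \<Longrightarrow> x \<in> {fst pq<..<snd pq} - N pq \<Longrightarrow> 0 < e \<Longrightarrow>
      \<exists>d>0. \<forall>t. \<bar>t - x\<bar> < d \<longrightarrow> \<bar>oint x t g - (t - x) * g x\<bar> \<le> e * \<bar>t - x\<bar>"
    by metis
  show thesis
  proof (rule that)
    show "(\<Union>pq\<in>Q. N pq) \<in> null_sets lebesgue"
      using N(1) cQ by (intro null_sets_UN') (auto simp: negligible_iff_null_sets)
    fix x e :: real assume x: "x \<in> ?I - (\<Union>pq\<in>Q. N pq)" and e: "0 < e"
    obtain d where d: "0 < d" "\<And>t. \<bar>t - x\<bar> < d \<Longrightarrow> t \<in> ?I"
      using x einterval_ball by blast
    obtain p where p: "p \<in> \<rat>" "x - d < p" "p < x" using Rats_dense_in_real[of "x - d" x] d(1) by auto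
    obtain q where q: "q \<in> \<rat>" "x < q" "q < x + d" using Rats_dense_in_real[of x "x + d"] d(1) by auto
    have "(p, q) \<in> Q" using p q d(2) by (auto simp: Q_def)
    with N(2)[of "(p, q)" x e] x p q e
    show "\<exists>d>0. \<forall>t. \<bar>t - x\<bar> < d \<longrightarrow> \<bar>oint x t g - (t - x) * g x\<bar> \<le> e * \<bar>t - x\<bar>" by auto
  qed
qed

text \<open>
  Apply the real case to \<open>\<parallel>f - q\<parallel>\<close> for all \<open>q\<close> in a countable dense set. Off the union of the null
  sets, the mean of \<open>\<parallel>f - f x\<parallel>\<close> is asymptotically at most \<open>2 \<parallel>f x - q\<parallel>\<close>, which is arbitrarily small.
\<close>

lemma lebesgue_differentiation:
  fixes f :: "real \<Rightarrow> 'a::{banach, second_countable_topology}"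
  assumes f: "f \<in> L1_loc a b"
  obtains N where "N \<in> null_sets lebesgue" "\<And>x. x \<in> einterval a b - N \<Longrightarrow> lebesgue_point f x"
proof -
  let ?I = "einterval a b"
  obtain D :: "'a set" where D: "countable D" "\<And>X. open X \<Longrightarrow> X \<noteq> {} \<Longrightarrow> \<exists>d\<in>D. d \<in> X"
    by (erule countable_dense_setE)
  have dense: "\<exists>d\<in>D. dist d u < e" if "0 < e" for u e
    using D(2)[of "ball u e"] that by (auto simp: dist_commute)
  have fq: "(\<lambda>s. norm (f s - q)) \<in> L1_loc a b" for q
    by (intro L1_loc_norm L1_loc_diff f L1_loc_const)
  have "\<exists>N\<in>null_sets lebesgue. \<forall>x\<in>?I - N. \<forall>e>0. \<exists>d>0. \<forall>t. \<bar>t - x\<bar> < d \<longrightarrow>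
      \<bar>oint x t (\<lambda>s. norm (f s - q)) - (t - x) * norm (f x - q)\<bar> \<le> e * \<bar>t - x\<bar>" for q
    by (rule lebesgue_differentiation_real[OF fq[of q]]) blast
  then obtain N where N: "\<And>q. N q \<in> null_sets lebesgue"
    "\<And>q x e. x \<in> ?I - N q \<Longrightarrow> 0 < e \<Longrightarrow> \<exists>d>0. \<forall>t. \<bar>t - x\<bar> < d \<longrightarrow>
      \<bar>oint x t (\<lambda>s. norm (f s - q)) - (t - x) * norm (f x - q)\<bar> \<le> e * \<bar>t - x\<bar>"
    by metis
  show thesis
  proof (rule that)
    show "(\<Union>q\<in>D. N q) \<in> null_sets lebesgue" using N(1) D(1) by (intro null_sets_UN') auto
    fix x assume x: "x \<in> ?I - (\<Union>q\<in>D. N q)"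
    then have xI: "x \<in> ?I" by simp
    show "lebesgue_point f x" unfolding lebesgue_point_def
    proof (intro allI impI)
      fix e :: real assume e: "0 < e"
      obtain q where q: "q \<in> D" "dist q (f x) < e / 3" using dense[of "e / 3"] e by auto
      obtain d1 where d1: "d1 > 0" "\<And>t. \<bar>t - x\<bar> < d1 \<Longrightarrow>
          \<bar>oint x t (\<lambda>s. norm (f s - q)) - (t - x) * norm (f x - q)\<bar> \<le> e / 3 * \<bar>t - x\<bar>"
        using N(2)[of x q "e / 3"] x q e by auto
      obtain d2 where d2: "d2 > 0" "\<And>t. \<bar>t - x\<bar> < d2 \<Longrightarrow> t \<in> ?I" using xI einterval_ball by blast
      have "\<bar>oint x t (\<lambda>s. norm (f s - f x))\<bar> \<le> e * \<bar>t - x\<bar>" if t: "\<bar>t - x\<bar> < min d1 d2" for t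
      proof -
        have tI: "t \<in> ?I" using t d2 by simp
        have nq: "norm (f x - q) \<le> e / 3" using q(2) by (simp add: dist_norm norm_minus_commute)
        have "\<bar>oint x t (\<lambda>s. norm (f s - f x))\<bar> \<le> \<bar>oint x t (\<lambda>s. norm (f s - q) + norm (f x - q))\<bar>"
        proof -
          have "norm (f s - f x) \<le> norm (f s - q) + norm (f x - q)" for s
            using norm_triangle_ineq4[of "f s - q" "f x - q"] by simp
          then show ?thesis
            using norm_oint_le[OF xI tI fq[of "f x"] L1_loc_add[OF fq[of q] L1_loc_const]] by simp
        qed
        also have "oint x t (\<lambda>s. norm (f s - q) + norm (f x - q)) =
            (oint x t (\<lambda>s. norm (f s - q)) - (t - x) * norm (f x - q)) + (t - x) * (2 * norm (f x - q))"
          by (simp add: oint_add[OF xI tI fq L1_loc_const])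
        also have "\<bar>\<dots>\<bar> \<le> e / 3 * \<bar>t - x\<bar> + \<bar>t - x\<bar> * (2 * norm (f x - q))"
          using d1(2)[of t] t by (intro order_trans[OF abs_triangle_ineq] add_mono) (auto simp: abs_mult)
        also have "\<dots> \<le> e / 3 * \<bar>t - x\<bar> + \<bar>t - x\<bar> * (2 * (e / 3))"
          using nq e by (intro add_mono mult_left_mono) auto
        finally show ?thesis by (simp add: algebra_simps)
      qed
      then show "\<exists>d>0. \<forall>t. \<bar>t - x\<bar> < d \<longrightarrow> \<bar>oint x t (\<lambda>s. norm (f s - f x))\<bar> \<le> e * \<bar>t - x\<bar>"
        using d1 d2 by (intro exI[of _ "min d1 d2"]) auto
    qed
  qed
qed

lemma lebesgue_point_continuous:
  assumes f: "continuous_on (einterval a b) f" and x: "x \<in> einterval a b"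
  shows "lebesgue_point f x"
  unfolding lebesgue_point_def
proof (intro allI impI)
  fix e :: real assume e: "0 < e"
  obtain d1 where d1: "d1 > 0" "\<And>t. \<bar>t - x\<bar> < d1 \<Longrightarrow> t \<in> einterval a b" using x einterval_ball by blast
  have "isCont f x" using f x by (simp add: continuous_on_eq_continuous_at)
  then obtain d2 where d2: "d2 > 0" "\<And>t. \<bar>t - x\<bar> < d2 \<Longrightarrow> norm (f t - f x) < e"
    using e by (metis continuous_at_eps_delta dist_norm real_norm_def)
  have "\<bar>oint x t (\<lambda>s. norm (f s - f x))\<bar> \<le> e * \<bar>t - x\<bar>" if t: "\<bar>t - x\<bar> < min d1 d2" for t
  proof -
    have "norm (oint x t (\<lambda>s. norm (f s - f x))) \<le> \<bar>oint x t (\<lambda>s. e)\<bar>"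
    proof (rule norm_oint_le[OF x])
      show "t \<in> einterval a b" using t d1 by simp
      show "(\<lambda>s. norm (f s - f x)) \<in> L1_loc a b"
        by (intro L1_loc_continuous continuous_intros f)
      fix s assume "s \<in> closed_segment x t"
      then have "\<bar>s - x\<bar> < d2" using t by (auto simp: closed_segment_eq_real_ivl split: if_splits)
      then show "norm (norm (f s - f x)) \<le> e" using d2(2)[of s] by simp
    qed (rule L1_loc_const)
    then show ?thesis using e by (simp add: abs_mult mult.commute)
  qed
  then show "\<exists>d>0. \<forall>t. \<bar>t - x\<bar> < d \<longrightarrow> \<bar>oint x t (\<lambda>s. norm (f s - f x))\<bar> \<le> e * \<bar>t - x\<bar>"
    using d1 d2 by (intro exI[of _ "min d1 d2"]) auto
qed

lemma lebesgue_point_diff: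
  assumes f: "f \<in> L1_loc a b" "lebesgue_point f x" and g: "g \<in> L1_loc a b" "lebesgue_point g x"
    and x: "x \<in> einterval a b"
  shows "lebesgue_point (\<lambda>t. f t - g t) x"
  unfolding lebesgue_point_def
proof (intro allI impI)
  fix e :: real assume e: "0 < e"
  obtain d where d: "d > 0" "\<And>t. \<bar>t - x\<bar> < d \<Longrightarrow> t \<in> einterval a b" using x einterval_ball by blast
  obtain d1 where d1: "d1 > 0" "\<And>t. \<bar>t - x\<bar> < d1 \<Longrightarrow> \<bar>oint x t (\<lambda>s. norm (f s - f x))\<bar> \<le> e/2 * \<bar>t - x\<bar>"
    using f(2) e unfolding lebesgue_point_def by (meson half_gt_zero)
  obtain d2 where d2: "d2 > 0" "\<And>t. \<bar>t - x\<bar> < d2 \<Longrightarrow> \<bar>oint x t (\<lambda>s. norm (g s - g x))\<bar> \<le> e/2 * \<bar>t - x\<bar>"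
    using g(2) e unfolding lebesgue_point_def by (meson half_gt_zero)
  have nf: "(\<lambda>s. norm (f s - f x)) \<in> L1_loc a b" and ng: "(\<lambda>s. norm (g s - g x)) \<in> L1_loc a b"
    by (intro L1_loc_norm L1_loc_diff f g L1_loc_const)+
  have "\<bar>oint x t (\<lambda>s. norm (f s - g s - (f x - g x)))\<bar> \<le> e * \<bar>t - x\<bar>" if t: "\<bar>t - x\<bar> < min d (min d1 d2)" for t
  proof -
    have tI: "t \<in> einterval a b" using t d by simp
    have "norm (oint x t (\<lambda>s. norm (f s - g s - (f x - g x)))) \<le> \<bar>oint x t (\<lambda>s. norm (f s - f x) + norm (g s - g x))\<bar>"
    proof (rule norm_oint_le[OF x tI _ L1_loc_add[OF nf ng]])
      fix s
      show "norm (norm (f s - g s - (f x - g x))) \<le> norm (f s - f x) + norm (g s - g x)"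
        using norm_triangle_ineq4[of "f s - f x" "g s - g x"] by (simp add: algebra_simps)
    qed (intro L1_loc_norm L1_loc_diff f g L1_loc_const)
    also have "\<dots> \<le> e/2 * \<bar>t - x\<bar> + e/2 * \<bar>t - x\<bar>"
      unfolding oint_add[OF x tI nf ng] using t d1(2)[of t] d2(2)[of t]
      by (intro order_trans[OF abs_triangle_ineq] add_mono) auto
    finally show ?thesis by simp
  qed
  then show "\<exists>d>0. \<forall>t. \<bar>t - x\<bar> < d \<longrightarrow> \<bar>oint x t (\<lambda>s. norm (f s - g s - (f x - g x)))\<bar> \<le> e * \<bar>t - x\<bar>"
    using d d1 d2 by (intro exI[of _ "min d (min d1 d2)"]) auto
qed

text \<open>
  The hypotheses at \<open>x\<close> do not involve \<open>y\<close>, so the same null set serves for all continuous \<open>y\<close>. The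
  reason is the splitting \<open>V s (y s) - V x (y x) = V s (y s - v) + (V s v - V x v) - V x (y x - v)\<close>
  with \<open>v \<in> D\<close> close to \<open>y x\<close>: the outer terms are small because \<open>\<parallel>V\<parallel>\<close> has bounded means near \<open>x\<close>.
\<close>

lemma lebesgue_point_operator:
  fixes V :: "real \<Rightarrow> 'a::{banach, second_countable_topology} \<Rightarrow>\<^sub>L 'a"
  assumes V: "(\<lambda>t. norm (V t)) \<in> L1_loc a b" "\<And>v. (\<lambda>t. V t v) \<in> L1_loc a b"
    and Vy: "(\<lambda>t. V t (y t)) \<in> L1_loc a b"
    and y: "continuous_on (einterval a b) y" and x: "x \<in> einterval a b"
    and D: "\<And>u e. 0 < e \<Longrightarrow> \<exists>d\<in>D. dist d u < e"
    and pts: "lebesgue_point (\<lambda>t. norm (V t)) x" "\<And>v. v \<in> D \<Longrightarrow> lebesgue_point (\<lambda>t. V t v) x"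
  shows "lebesgue_point (\<lambda>t. V t (y t)) x"
  unfolding lebesgue_point_def
proof (intro allI impI)
  fix e :: real assume e: "0 < e"
  let ?I = "einterval a b"
  define M where "M = norm (V x)"
  \<comment> \<open>The constant error \<open>2 M h\<close> may use up a third of \<open>e\<close>; \<open>h \<le> 1\<close> controls the oscillation of \<open>\<parallel>V\<parallel>\<close>.\<close>
  define h where "h = min 1 (e / (6 * M + 1))"
  have M: "0 \<le> M" by (simp add: M_def)
  then have h: "0 < h" "h \<le> 1" using e by (auto simp: h_def)
  have "2 * M * h \<le> e / 3"
  proof -
    have "h * (6 * M + 1) \<le> e" using M by (simp add: h_def min_le_iff_disj pos_le_divide_eq[symmetric])
    then show ?thesis using h by (simp add: algebra_simps)
  qed
  obtain v where v: "v \<in> D" "dist v (y x) < h / 2" using D[of "h / 2"] h by auto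
  have "isCont y x" using y x by (simp add: continuous_on_eq_continuous_at)
  then obtain d0 where d0: "d0 > 0" "\<And>t. \<bar>t - x\<bar> < d0 \<Longrightarrow> dist (y t) (y x) < h / 2"
    using h by (metis continuous_at_eps_delta dist_norm half_gt_zero real_norm_def)
  have near: "norm (y s - v) \<le> h" if "\<bar>s - x\<bar> < d0" for s
    using d0(2)[OF that] v(2) dist_triangle2[of "y s" v "y x"] by (simp add: dist_norm)
  obtain d where d: "d > 0" "\<And>t. \<bar>t - x\<bar> < d \<Longrightarrow> t \<in> ?I" using x einterval_ball by blast
  obtain d1 where d1: "d1 > 0" "\<And>t. \<bar>t - x\<bar> < d1 \<Longrightarrow> \<bar>oint x t (\<lambda>s. norm (norm (V s) - norm (V x)))\<bar> \<le> e/3 * \<bar>t - x\<bar>"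
    using pts(1) e unfolding lebesgue_point_def by (meson divide_pos_pos zero_less_numeral)
  obtain d2 where d2: "d2 > 0" "\<And>t. \<bar>t - x\<bar> < d2 \<Longrightarrow> \<bar>oint x t (\<lambda>s. norm (V s v - V x v))\<bar> \<le> e/3 * \<bar>t - x\<bar>"
    using pts(2)[OF v(1)] e unfolding lebesgue_point_def by (meson divide_pos_pos zero_less_numeral)
  have n1: "(\<lambda>s. norm (norm (V s) - norm (V x))) \<in> L1_loc a b" and n2: "(\<lambda>s. norm (V s v - V x v)) \<in> L1_loc a b"
    by (intro L1_loc_norm L1_loc_diff V L1_loc_const)+
  have "\<bar>oint x t (\<lambda>s. norm (V s (y s) - V x (y x)))\<bar> \<le> e * \<bar>t - x\<bar>"
    if t: "\<bar>t - x\<bar> < min (min d0 d) (min d1 d2)" for t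
  proof -
    have tI: "t \<in> ?I" using t d by simp
    have "norm (oint x t (\<lambda>s. norm (V s (y s) - V x (y x)))) \<le>
        \<bar>oint x t (\<lambda>s. (norm (norm (V s) - norm (V x)) + norm (V s v - V x v)) + e / 3)\<bar>"
    proof (rule norm_oint_le[OF x tI _ L1_loc_add[OF L1_loc_add[OF n1 n2] L1_loc_const]])
      show "(\<lambda>s. norm (V s (y s) - V x (y x))) \<in> L1_loc a b"
        by (intro L1_loc_norm L1_loc_diff Vy L1_loc_const)
      fix s assume "s \<in> closed_segment x t"
      then have s: "\<bar>s - x\<bar> < d0" using t by (auto simp: closed_segment_eq_real_ivl split: if_splits)
      have "V s (y s) - V x (y x) = V s (y s - v) + (V s v - V x v) - V x (y x - v)"
        unfolding blinfun.diff_right by (simp only: diff_add_cancel add_diff_eq diff_diff_eq2 diff_right_commute)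
      then have "norm (V s (y s) - V x (y x)) \<le> norm (V s (y s - v) + (V s v - V x v)) + norm (V x (y x - v))"
        by (simp only: norm_triangle_ineq4)
      moreover have "norm (V s (y s - v) + (V s v - V x v)) \<le> norm (V s (y s - v)) + norm (V s v - V x v)"
        by (rule norm_triangle_ineq)
      moreover have "norm (V s (y s - v)) \<le> norm (V s) * h"
        using norm_blinfun[of "V s" "y s - v"] near[OF s] by (meson mult_left_mono norm_ge_zero order_trans)
      moreover have "norm (V x (y x - v)) \<le> M * h"
        using norm_blinfun[of "V x" "y x - v"] near[of x] d0(1) unfolding M_def
        by (metis abs_zero diff_self mult_left_mono norm_ge_zero order_trans)
      moreover have "norm (V s) * h \<le> norm (norm (V s) - norm (V x)) + M * h"
      proof -
        have "norm (V s) * h = (norm (V s) - norm (V x)) * h + M * h" by (simp add: M_def algebra_simps)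
        also have "(norm (V s) - norm (V x)) * h \<le> norm (norm (V s) - norm (V x)) * 1"
          using h by (intro mult_mono) auto
        finally show ?thesis by simp
      qed
      ultimately show "norm (norm (V s (y s) - V x (y x))) \<le> norm (norm (V s) - norm (V x)) + norm (V s v - V x v) + e / 3"
        using \<open>2 * M * h \<le> e / 3\<close> by simp
    qed
    also have "oint x t (\<lambda>s. (norm (norm (V s) - norm (V x)) + norm (V s v - V x v)) + e / 3) =
      (oint x t (\<lambda>s. norm (norm (V s) - norm (V x))) + oint x t (\<lambda>s. norm (V s v - V x v))) + (t - x) * (e / 3)"
      by (subst oint_add[OF x tI L1_loc_add[OF n1 n2] L1_loc_const], subst oint_add[OF x tI n1 n2]) simp
    also have "\<bar>\<dots>\<bar> \<le> (e/3 * \<bar>t - x\<bar> + e/3 * \<bar>t - x\<bar>) + \<bar>t - x\<bar> * (e / 3)"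
      using t d1(2)[of t] d2(2)[of t] e
      by (intro order_trans[OF abs_triangle_ineq] add_mono) (auto simp: abs_mult)
    finally show ?thesis by (simp add: algebra_simps)
  qed
  then show "\<exists>d>0. \<forall>t. \<bar>t - x\<bar> < d \<longrightarrow> \<bar>oint x t (\<lambda>s. norm (V s (y s) - V x (y x)))\<bar> \<le> e * \<bar>t - x\<bar>"
    using d0 d d1 d2 by (intro exI[of _ "min (min d0 d) (min d1 d2)"]) auto
qed

lemma has_vector_derivative_oint:
  fixes f :: "real \<Rightarrow> 'a::{banach, second_countable_topology}"
  assumes f: "f \<in> L1_loc a b" and x0: "x0 \<in> einterval a b" and x: "x \<in> einterval a b"
    and Y: "\<And>t. t \<in> einterval a b \<Longrightarrow> Y t = c + oint x0 t f" and pt: "lebesgue_point f x"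
  shows "(Y has_vector_derivative f x) (at x)"
  unfolding has_vector_derivative_def has_derivative_at_alt
proof (intro conjI allI impI)
  show "bounded_linear (\<lambda>h. h *\<^sub>R f x)" by (rule bounded_linear_scaleR_left)
  fix e :: real assume e: "0 < e"
  obtain d where d: "d > 0" "\<And>t. \<bar>t - x\<bar> < d \<Longrightarrow> t \<in> einterval a b" using x einterval_ball by blast
  obtain d1 where d1: "d1 > 0" "\<And>t. \<bar>t - x\<bar> < d1 \<Longrightarrow> \<bar>oint x t (\<lambda>s. norm (f s - f x))\<bar> \<le> e * \<bar>t - x\<bar>"
    using pt e unfolding lebesgue_point_def by meson
  have "norm (Y t - Y x - (t - x) *\<^sub>R f x) \<le> e * norm (t - x)" if t: "norm (t - x) < min d d1" for t
  proof -
    have tI: "t \<in> einterval a b" using t d by simp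
    have "Y t - Y x = oint x t f"
      unfolding Y[OF tI] Y[OF x] add_diff_cancel_left by (rule oint_endpoint_diff[OF f x0 x tI])
    then have "Y t - Y x - (t - x) *\<^sub>R f x = oint x t (\<lambda>s. f s - f x)"
      by (simp add: oint_diff[OF x tI f L1_loc_const])
    moreover have "norm (oint x t (\<lambda>s. f s - f x)) \<le> \<bar>oint x t (\<lambda>s. norm (f s - f x))\<bar>"
      by (rule norm_oint_le[OF x tI]) (intro L1_loc_norm L1_loc_diff f L1_loc_const order_refl)+
    ultimately show ?thesis using d1(2)[of t] t by simp
  qed
  then show "\<exists>d>0. \<forall>t. norm (t - x) < d \<longrightarrow> norm (Y t - Y x - (t - x) *\<^sub>R f x) \<le> e * norm (t - x)"
    using d d1 by (intro exI[of _ "min d d1"]) auto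
qed

section \<open>The Schroedinger equation as a first-order system\<close>

lemma norm_fst_le_norm: "norm (fst p) \<le> norm p" and norm_snd_le_norm: "norm (snd p) \<le> norm p"
  by (metis norm_fst_le prod.collapse, metis norm_snd_le prod.collapse)

lemma weakly_measurable_L1_loc:
  assumes V: "weakly_measurable a b V" "(\<lambda>x. norm (V x)) \<in> L1_loc a b"
  shows "(\<lambda>x. V x v) \<in> L1_loc a b"
proof (rule L1_loc_bound)
  show "(\<lambda>x. norm v * norm (V x)) \<in> L1_loc a b"
    using L1_loc_cmult[OF continuous_on_const V(2), of "norm v"] by simp
  show "(\<lambda>x. V x v) \<in> borel_measurable (lebesgue_on (einterval a b))"
    using V(1) by (intro pettis_measurable) (simp add: weakly_measurable_def)
  show "norm (V x v) \<le> norm (norm v * norm (V x))" for x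
    using norm_blinfun[of "V x" v] by (simp add: mult.commute)
qed

text \<open>
  The right-hand side of the first-order system for \<open>p = (y, y')\<close>.
\<close>

definition schroedinger_field ::
  "(real \<Rightarrow> 'h \<Rightarrow>\<^sub>L 'h::complex_hilbert_space) \<Rightarrow> complex \<Rightarrow> (real \<Rightarrow> 'h) \<Rightarrow> real \<Rightarrow> 'h \<times> 'h \<Rightarrow> 'h \<times> 'h" where
  "schroedinger_field V z f t p = (snd p, V t (fst p) - z *\<^sub>C fst p - f t)"

definition schroedinger_weight :: "(real \<Rightarrow> 'h \<Rightarrow>\<^sub>L 'h::complex_hilbert_space) \<Rightarrow> complex \<Rightarrow> real \<Rightarrow> real" where
  "schroedinger_weight V z t = 1 + cmod z + norm (V t)"

lemma schroedinger_caratheodory_lipschitz: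
  fixes V :: "real \<Rightarrow> 'h \<Rightarrow>\<^sub>L 'h::{complex_hilbert_space, second_countable_topology}"
  assumes V: "weakly_measurable a b V" "(\<lambda>x. norm (V x)) \<in> L1_loc a b" and f: "f \<in> L1_loc a b"
  shows "caratheodory_lipschitz a b (schroedinger_weight V z) (schroedinger_field V z f)"
  unfolding caratheodory_lipschitz_def
proof (intro conjI ballI allI)
  show "schroedinger_weight V z \<in> L1_loc a b"
    unfolding schroedinger_weight_def[abs_def] by (intro L1_loc_add L1_loc_const V)
  show "(\<lambda>t. schroedinger_field V z f t p) \<in> L1_loc a b" for p
    unfolding schroedinger_field_def
    by (intro L1_loc_Pair L1_loc_diff L1_loc_const weakly_measurable_L1_loc V f)
next
  fix t :: real and p q :: "'h \<times> 'h"
  let ?u = "fst p - fst q" and ?v = "snd p - snd q"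
  have "schroedinger_field V z f t p - schroedinger_field V z f t q = (?v, V t ?u - z *\<^sub>C ?u)"
    by (simp add: schroedinger_field_def blinfun.diff_right scaleC.diff_right)
  also have "norm \<dots> \<le> norm ?v + (norm (V t ?u) + norm (z *\<^sub>C ?u))"
    by (rule order_trans[OF norm_Pair_le]) (rule add_left_mono, rule norm_triangle_ineq4)
  also have "\<dots> \<le> norm ?v + (norm (V t) * norm ?u + cmod z * norm ?u)"
    using norm_blinfun[of "V t" ?u] by simp
  also have "\<dots> \<le> norm (p - q) + (norm (V t) * norm (p - q) + cmod z * norm (p - q))"
    using norm_fst_le_norm[of "p - q"] norm_snd_le_norm[of "p - q"] by (intro add_mono mult_left_mono) auto
  finally show "norm (schroedinger_field V z f t p - schroedinger_field V z f t q)
      \<le> schroedinger_weight V z t * norm (p - q)"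
    by (simp add: schroedinger_weight_def algebra_simps)
qed (simp add: schroedinger_weight_def)

definition integral_solution ::
    "ereal \<Rightarrow> ereal \<Rightarrow> (real \<Rightarrow> 'h \<Rightarrow>\<^sub>L 'h) \<Rightarrow> complex \<Rightarrow> real \<Rightarrow> 'h \<Rightarrow> 'h \<Rightarrow> (real \<Rightarrow> 'h) \<Rightarrow>
     (real \<Rightarrow> 'h \<times> 'h::{complex_hilbert_space, second_countable_topology}) \<Rightarrow> bool" where
  "integral_solution a b V z x0 h0 h1 f Y \<longleftrightarrow> continuous_on (einterval a b) Y \<and>
     (\<forall>x \<in> einterval a b. Y x = (h0, h1) + oint x0 x (\<lambda>t. schroedinger_field V z f t (Y t)))"

context
  fixes a b :: ereal and x0 :: real
    and V :: "real \<Rightarrow> 'h \<Rightarrow>\<^sub>L ('h::{complex_hilbert_space, second_countable_topology})"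
  assumes V: "weakly_measurable a b V" "(\<lambda>x. norm (V x)) \<in> L1_loc a b"
    and x0: "x0 \<in> einterval a b"
begin

lemma integral_solution_exists:
  assumes "f \<in> L1_loc a b"
  shows "\<exists>Y. integral_solution a b V z x0 h0 h1 f Y"
  using caratheodory_existence[OF schroedinger_caratheodory_lipschitz[OF V assms] x0, of "(h0, h1)"]
  unfolding integral_solution_def by metis

lemma integral_solution_perturbation:
  assumes f: "f \<in> L1_loc a b" and Y: "integral_solution a b V z x0 h0 h1 f Y"
    and g: "g \<in> L1_loc a b" and P: "\<And>x. x \<in> einterval a b \<Longrightarrow> P x = P0 + oint x0 x g"
    and x: "x \<in> einterval a b"
  shows "norm (Y x - P x) \<le> 2 * (norm ((h0, h1) - P0) +
    \<bar>oint x0 x (\<lambda>t. norm (g t - schroedinger_field V z f t (P t)))\<bar>) *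
    exp (4 * \<bar>oint x0 x (schroedinger_weight V z)\<bar>)"
  using Y unfolding integral_solution_def
  by (intro caratheodory_perturbation[OF schroedinger_caratheodory_lipschitz[OF V f] x0 _ _ g P x]) auto

lemma integral_solution_field_L1_loc:
  assumes f: "f \<in> L1_loc a b" and Y: "integral_solution a b V z x0 h0 h1 f Y"
  shows "(\<lambda>t. schroedinger_field V z f t (Y t)) \<in> L1_loc a b"
  using Y unfolding integral_solution_def
  by (intro caratheodory_compose_L1_loc[OF schroedinger_caratheodory_lipschitz[OF V f] x0]) auto

text \<open>
  The solution for one set of data solves the system for the other with defect \<open>(0, f - g)\<close>.
\<close>

lemma integral_solution_dependence:
  assumes f: "f \<in> L1_loc a b" and Y: "integral_solution a b V z x0 h0 h1 f Y"
    and g: "g \<in> L1_loc a b" and Z: "integral_solution a b V z x0 k0 k1 g Z"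
    and x: "x \<in> einterval a b"
  shows "norm (Y x - Z x) \<le> 2 * exp (4 * \<bar>oint x0 x (schroedinger_weight V z)\<bar>) *
    (norm (h0 - k0) + norm (h1 - k1) + \<bar>oint x0 x (\<lambda>t. norm (f t - g t))\<bar>)"
proof -
  let ?E = "exp (4 * \<bar>oint x0 x (schroedinger_weight V z)\<bar>)"
  have "norm (Y x - Z x) \<le> 2 * (norm ((h0, h1) - (k0, k1)) +
    \<bar>oint x0 x (\<lambda>t. norm (schroedinger_field V z g t (Z t) - schroedinger_field V z f t (Z t)))\<bar>) * ?E"
    using Z unfolding integral_solution_def
    by (intro integral_solution_perturbation[OF f Y integral_solution_field_L1_loc[OF g Z] _ x]) auto
  also have "(\<lambda>t. norm (schroedinger_field V z g t (Z t) - schroedinger_field V z f t (Z t))) = (\<lambda>t. norm (f t - g t))"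
    by (simp add: schroedinger_field_def norm_Pair)
  also have "2 * (norm ((h0, h1) - (k0, k1)) + \<bar>oint x0 x (\<lambda>t. norm (f t - g t))\<bar>) * ?E
    \<le> 2 * (norm (h0 - k0) + norm (h1 - k1) + \<bar>oint x0 x (\<lambda>t. norm (f t - g t))\<bar>) * ?E"
    using norm_Pair_le[of "h0 - k0" "h1 - k1"] by (intro mult_right_mono) auto
  finally show ?thesis by (simp only: mult.commute mult.left_commute mult.assoc)
qed

lemma integral_solution_unique:
  assumes f: "f \<in> L1_loc a b" and "integral_solution a b V z x0 h0 h1 f Y"
    and "integral_solution a b V z x0 h0 h1 f Z" and x: "x \<in> einterval a b"
  shows "Y x = Z x"
  using integral_solution_dependence[OF f assms(2) f assms(3) x] by simp

lemma operator_compose_L1_loc: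
  fixes y :: "real \<Rightarrow> 'h"
  assumes "continuous_on (einterval a b) y"
  shows "(\<lambda>t. V t (y t)) \<in> L1_loc a b"
proof (rule caratheodory_compose_L1_loc[OF _ x0 assms])
  show "caratheodory_lipschitz a b (\<lambda>t. norm (V t)) (\<lambda>t. blinfun_apply (V t))"
    unfolding caratheodory_lipschitz_def
    using V norm_blinfun by (auto simp: blinfun.diff_right[symmetric] weakly_measurable_L1_loc)
qed

text \<open>
  The null set is chosen from \<open>f\<close> and \<open>V\<close> alone, before \<open>z\<close>, the initial values and the solution enter.
\<close>

lemma exceptional_set:
  assumes f: "f \<in> L1_loc a b"
  obtains E where "E \<in> null_sets lebesgue" "\<And>x. x \<in> einterval a b - E \<Longrightarrow> lebesgue_point f x"
    "\<And>x (y :: real \<Rightarrow> 'h). x \<in> einterval a b - E \<Longrightarrow> continuous_on (einterval a b) y \<Longrightarrow> lebesgue_point (\<lambda>t. V t (y t)) x"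
proof -
  let ?I = "einterval a b"
  obtain D :: "'h set" where D: "countable D" "\<And>X. open X \<Longrightarrow> X \<noteq> {} \<Longrightarrow> \<exists>d\<in>D. d \<in> X"
    by (erule countable_dense_setE)
  have dense: "\<exists>d\<in>D. dist d u < e" if "0 < e" for u e
    using D(2)[of "ball u e"] that by (auto simp: dist_commute)
  obtain N0 where N0: "N0 \<in> null_sets lebesgue" "\<And>x. x \<in> ?I - N0 \<Longrightarrow> lebesgue_point f x"
    using lebesgue_differentiation[OF f] by metis
  obtain N1 where N1: "N1 \<in> null_sets lebesgue" "\<And>x. x \<in> ?I - N1 \<Longrightarrow> lebesgue_point (\<lambda>t. norm (V t)) x"
    using lebesgue_differentiation[OF V(2)] by metis
  have "\<exists>N. N \<in> null_sets lebesgue \<and> (\<forall>x \<in> ?I - N. lebesgue_point (\<lambda>t. V t v) x)" for v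
    using lebesgue_differentiation[OF weakly_measurable_L1_loc[OF V]] by metis
  then obtain N where N: "\<And>v. N v \<in> null_sets lebesgue" "\<And>v x. x \<in> ?I - N v \<Longrightarrow> lebesgue_point (\<lambda>t. V t v) x"
    by metis
  show thesis
  proof (rule that)
    have "(\<Union>v\<in>D. N v) \<in> null_sets lebesgue" using N(1) D(1) by (intro null_sets_UN') auto
    then show "N0 \<union> N1 \<union> (\<Union>v\<in>D. N v) \<in> null_sets lebesgue" using N0(1) N1(1) by (intro null_sets.Un)
    fix x assume x: "x \<in> ?I - (N0 \<union> N1 \<union> (\<Union>v\<in>D. N v))"
    then show "lebesgue_point f x" using N0(2) by blast
    fix y :: "real \<Rightarrow> 'h" assume y: "continuous_on ?I y"
    show "lebesgue_point (\<lambda>t. V t (y t)) x"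
    proof (rule lebesgue_point_operator[OF V(2) weakly_measurable_L1_loc[OF V] operator_compose_L1_loc[OF y] y _ dense])
      show "lebesgue_point (\<lambda>t. norm (V t)) x" using N1(2) x by blast
      show "lebesgue_point (\<lambda>t. V t v) x" if "v \<in> D" for v using N(2) x that by blast
    qed (use x in auto)
  qed
qed

context
  fixes z h0 h1 f Y
  assumes f: "f \<in> L1_loc a b" and Y: "integral_solution a b V z x0 h0 h1 f Y"
begin

lemma integral_solution_continuous:
  "continuous_on (einterval a b) (\<lambda>t. fst (Y t))" "continuous_on (einterval a b) (\<lambda>t. snd (Y t))"
  using Y unfolding integral_solution_def by (blast intro: continuous_on_fst continuous_on_snd)+

lemma integral_solution_components:
  assumes x: "x \<in> einterval a b"
  shows "fst (Y x) = h0 + oint x0 x (\<lambda>t. snd (Y t))"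
    and "snd (Y x) = h1 + oint x0 x (\<lambda>t. V t (fst (Y t)) - z *\<^sub>C fst (Y t) - f t)"
proof -
  have eq: "Y x = (h0, h1) + oint x0 x (\<lambda>t. schroedinger_field V z f t (Y t))"
    using Y x unfolding integral_solution_def by blast
  show "fst (Y x) = h0 + oint x0 x (\<lambda>t. snd (Y t))"
    unfolding eq fst_add
      oint_bounded_linear[OF x0 x bounded_linear_fst integral_solution_field_L1_loc[OF f Y], symmetric]
    by (simp add: schroedinger_field_def)
  show "snd (Y x) = h1 + oint x0 x (\<lambda>t. V t (fst (Y t)) - z *\<^sub>C fst (Y t) - f t)"
    unfolding eq snd_add
      oint_bounded_linear[OF x0 x bounded_linear_snd integral_solution_field_L1_loc[OF f Y], symmetric]
    by (simp add: schroedinger_field_def)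
qed

lemma integral_solution_has_derivative:
  assumes x: "x \<in> einterval a b"
  shows "((\<lambda>t. fst (Y t)) has_vector_derivative snd (Y x)) (at x)"
  using integral_solution_components(1)
  by (rule has_vector_derivative_oint[OF L1_loc_continuous[OF integral_solution_continuous(2)] x0 x])
    (auto intro: lebesgue_point_continuous[OF integral_solution_continuous(2) x])

lemma integral_solution_strong_deriv:
  "x \<in> einterval a b \<Longrightarrow> strong_deriv (\<lambda>t. fst (Y t)) x = snd (Y x)"
  by (rule vector_derivative_at) (rule integral_solution_has_derivative)

lemma integral_solution_forcing_L1_loc:
  "(\<lambda>t. V t (fst (Y t)) - z *\<^sub>C fst (Y t) - f t) \<in> L1_loc a b"
  by (intro L1_loc_diff f operator_compose_L1_loc integral_solution_continuous
      L1_loc_bounded_linear[OF scaleC.bounded_linear_right] L1_loc_continuous)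

lemma integral_solution_has_second_derivative:
  assumes x: "x \<in> einterval a b" and f_pt: "lebesgue_point f x"
    and V_pt: "\<And>y. continuous_on (einterval a b) y \<Longrightarrow> lebesgue_point (\<lambda>t. V t (y t)) x"
  shows "(strong_deriv (\<lambda>t. fst (Y t)) has_vector_derivative V x (fst (Y x)) - z *\<^sub>C fst (Y x) - f x) (at x)"
proof -
  note y = integral_solution_continuous(1)
  have zy: "continuous_on (einterval a b) (\<lambda>t. z *\<^sub>C fst (Y t))"
    by (rule continuous_on_compose2[OF linear_continuous_on[OF scaleC.bounded_linear_right] y]) auto
  have "lebesgue_point (\<lambda>t. V t (fst (Y t)) - z *\<^sub>C fst (Y t) - f t) x"
    by (intro lebesgue_point_diff[OF L1_loc_diff _ f f_pt x] lebesgue_point_diff[OF _ _ _ _ x]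
        operator_compose_L1_loc[OF y] V_pt[OF y] L1_loc_continuous[OF zy] lebesgue_point_continuous[OF zy x])
  then have "((\<lambda>t. snd (Y t)) has_vector_derivative V x (fst (Y x)) - z *\<^sub>C fst (Y x) - f x) (at x)"
    using integral_solution_components(2)
    by (intro has_vector_derivative_oint[OF integral_solution_forcing_L1_loc x0 x]) auto
  then show ?thesis
    by (rule has_vector_derivative_transform_within_open[of _ _ _ "einterval a b"])
      (use x integral_solution_strong_deriv in auto)
qed

lemma integral_solution_solves_ivp:
  assumes E: "E \<in> null_sets lebesgue" and f_pt: "\<And>x. x \<in> einterval a b - E \<Longrightarrow> lebesgue_point f x"
    and V_pt: "\<And>x y. x \<in> einterval a b - E \<Longrightarrow> continuous_on (einterval a b) y \<Longrightarrow> lebesgue_point (\<lambda>t. V t (y t)) x"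
  shows "solves_ivp a b V z x0 h0 h1 f E (\<lambda>t. fst (Y t))"
proof -
  let ?I = "einterval a b" and ?y = "\<lambda>t. fst (Y t)" and ?g = "\<lambda>t. V t (fst (Y t)) - z *\<^sub>C fst (Y t) - f t"
  have d2: "(strong_deriv ?y has_vector_derivative ?g x) (at x)" if "x \<in> ?I - E" for x
    using that by (intro integral_solution_has_second_derivative f_pt V_pt) auto
  then have d2': "strong_deriv (strong_deriv ?y) x = ?g x" if "x \<in> ?I - E" for x
    using that by (intro vector_derivative_at)
  have L1: "strong_deriv ?y \<in> L1_loc a b"
    by (rule L1_loc_cong_AE[OF L1_loc_continuous[OF integral_solution_continuous(2)], of "{}"])
      (auto simp: integral_solution_strong_deriv)
  have L2: "strong_deriv (strong_deriv ?y) \<in> L1_loc a b"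
    by (rule L1_loc_cong_AE[OF integral_solution_forcing_L1_loc E]) (simp add: d2')
  have int: "?y x = ?y x1 + oint x1 x (strong_deriv ?y) \<and>
      strong_deriv ?y x = strong_deriv ?y x1 + oint x1 x (strong_deriv (strong_deriv ?y))"
    if x1: "x1 \<in> ?I" and x: "x \<in> ?I" for x1 x
  proof
    have "oint x1 x (strong_deriv ?y) = oint x1 x (\<lambda>t. snd (Y t))"
      using einterval_segment_subset[OF x1 x] by (intro oint_cong integral_solution_strong_deriv) auto
    also have "\<dots> = ?y x - ?y x1"
      unfolding integral_solution_components(1)[OF x] integral_solution_components(1)[OF x1] add_diff_cancel_left
      by (rule oint_endpoint_diff[OF L1_loc_continuous[OF integral_solution_continuous(2)] x0 x1 x, symmetric])
    finally show "?y x = ?y x1 + oint x1 x (strong_deriv ?y)" by simp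
    have "oint x1 x (strong_deriv (strong_deriv ?y)) = oint x1 x ?g"
      by (rule oint_cong_AE[OF x1 x integral_solution_forcing_L1_loc E, symmetric]) (simp add: d2')
    also have "\<dots> = snd (Y x) - snd (Y x1)"
      unfolding integral_solution_components(2)[OF x] integral_solution_components(2)[OF x1] add_diff_cancel_left
      by (rule oint_endpoint_diff[OF integral_solution_forcing_L1_loc x0 x1 x, symmetric])
    finally show "strong_deriv ?y x = strong_deriv ?y x1 + oint x1 x (strong_deriv (strong_deriv ?y))"
      using x x1 by (simp add: integral_solution_strong_deriv)
  qed
  have W: "?y \<in> W21_loc a b"
    unfolding W21_loc_def oint_def[symmetric] mem_Collect_eq using L1 L2 int by blast
  have ode: "\<forall>x \<in> ?I - E. strong_deriv ?y differentiable (at x) \<and>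
        - strong_deriv (strong_deriv ?y) x + (V x (?y x) - z *\<^sub>C ?y x) = f x"
    using d2' by (auto intro: differentiableI_vector[OF d2])
  have ic: "?y x0 = h0" "strong_deriv ?y x0 = h1"
    unfolding integral_solution_strong_deriv[OF x0]
    by (simp_all only: integral_solution_components[OF x0] oint_refl add_0_right)
  show ?thesis unfolding solves_ivp_def by (intro conjI W ode ic)
qed

lemma integral_solution_C1: "(\<lambda>t. fst (Y t)) C1_differentiable_on einterval a b"
  unfolding C1_differentiable_on_def
  by (intro exI[of _ "\<lambda>t. snd (Y t)"] conjI ballI integral_solution_has_derivative integral_solution_continuous)

end

text \<open>
  The regularity built into \<^const>\<open>W21_loc\<close> turns a differential equation that holds almost
  everywhere into the integral equation, to which uniqueness applies.
\<close>

lemma solves_ivp_integral_solution: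
  assumes f: "f \<in> L1_loc a b" and N: "N \<in> null_sets lebesgue"
    and u: "solves_ivp a b V z x0 h0 h1 f N u"
  shows "integral_solution a b V z x0 h0 h1 f (\<lambda>x. (u x, strong_deriv u x))"
proof -
  let ?I = "einterval a b" and ?v = "strong_deriv u" and ?w = "strong_deriv (strong_deriv u)"
  have W: "u \<in> W21_loc a b" and ic: "u x0 = h0" "?v x0 = h1"
    and eq: "\<And>x. x \<in> ?I - N \<Longrightarrow> - ?w x + (V x (u x) - z *\<^sub>C u x) = f x"
    using u unfolding solves_ivp_def by blast+
  have L: "?v \<in> L1_loc a b" "?w \<in> L1_loc a b"
    and "\<And>x. x \<in> ?I \<Longrightarrow> u x = u x0 + oint x0 x ?v \<and> ?v x = ?v x0 + oint x0 x ?w"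
    using W x0 unfolding W21_loc_def oint_def by blast+
  then have int: "u x = h0 + oint x0 x ?v" "?v x = h1 + oint x0 x ?w" if "x \<in> ?I" for x
    using that unfolding ic by blast+
  have cont: "continuous_on ?I (\<lambda>x. h0 + oint x0 x ?v)" "continuous_on ?I (\<lambda>x. h1 + oint x0 x ?w)"
    by (rule continuous_on_add[OF continuous_on_const continuous_on_oint[OF L(1) x0]],
        rule continuous_on_add[OF continuous_on_const continuous_on_oint[OF L(2) x0]])
  have cu: "continuous_on ?I u" "continuous_on ?I ?v"
    by (rule continuous_on_cong[THEN iffD2, OF refl int(1) cont(1)], assumption,
        rule continuous_on_cong[THEN iffD2, OF refl int(2) cont(2)], assumption)
  show ?thesis unfolding integral_solution_def
  proof (intro conjI ballI)
    show "continuous_on ?I (\<lambda>x. (u x, ?v x))" by (intro continuous_intros cu)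
    fix x assume x: "x \<in> ?I"
    have "(\<lambda>t. (?v t, ?w t)) \<in> L1_loc a b" by (intro L1_loc_Pair L)
    note oint_bounded_linear[OF x0 x bounded_linear_fst this] oint_bounded_linear[OF x0 x bounded_linear_snd this]
    then have "oint x0 x (\<lambda>t. (?v t, ?w t)) = (oint x0 x ?v, oint x0 x ?w)"
      by (simp add: prod_eq_iff)
    moreover have "oint x0 x (\<lambda>t. (?v t, ?w t)) = oint x0 x (\<lambda>t. schroedinger_field V z f t (u t, ?v t))"
    proof (rule oint_cong_AE[OF x0 x L1_loc_Pair[OF L] N])
      fix t assume "t \<in> ?I - N"
      from eq[OF this] show "(?v t, ?w t) = schroedinger_field V z f t (u t, ?v t)"
        by (simp add: schroedinger_field_def algebra_simps)
    qed
    ultimately have "oint x0 x (\<lambda>t. schroedinger_field V z f t (u t, ?v t)) = (oint x0 x ?v, oint x0 x ?w)"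
      by (simp only:)
    then show "(u x, ?v x) = (h0, h1) + oint x0 x (\<lambda>t. schroedinger_field V z f t (u t, ?v t))"
      by (simp only: int[OF x] add_Pair)
  qed
qed

text \<open>
  Complex linearity of \<open>V t\<close> enters in the computation of the defect of \<open>P = Y\<^sub>z + (w - z) D\<close>, which
  is exactly \<open>(0, (w - z)\<^sup>2 d)\<close> for the first component \<open>d\<close> of \<open>D\<close>.
\<close>

lemma integral_solution_entire:
  assumes lin: "\<And>x. x \<in> einterval a b \<Longrightarrow> complex_linear (V x)"
    and f: "f \<in> L1_loc a b" and Y: "\<And>w. integral_solution a b V w x0 h0 h1 f (Y w)"
    and x: "x \<in> einterval a b"
  shows "entire (\<lambda>z. fst (Y z x))" and "entire (\<lambda>z. snd (Y z x))"
proof -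
  let ?I = "einterval a b"
  have "\<exists>D K. \<forall>w. cmod (w - z) \<le> 1 \<longrightarrow>
     norm (Y w x - Y z x - ((w - z) *\<^sub>C fst D, (w - z) *\<^sub>C snd D)) \<le> K * (cmod (w - z))\<^sup>2" for z
  proof -
    have y: "(\<lambda>t. fst (Y z t)) \<in> L1_loc a b"
      by (rule L1_loc_continuous[OF integral_solution_continuous(1)[OF f Y]])
    obtain D where D: "integral_solution a b V z x0 0 0 (\<lambda>t. fst (Y z t)) D"
      using integral_solution_exists[OF y] by metis
    have nd: "(\<lambda>t. norm (fst (D t))) \<in> L1_loc a b"
      by (intro L1_loc_norm L1_loc_continuous integral_solution_continuous(1)[OF y D])
    have wl: "schroedinger_weight V w \<in> L1_loc a b" for w
      using schroedinger_caratheodory_lipschitz[OF V f] by (simp add: caratheodory_lipschitz_def)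
    \<comment> \<open>This \<open>W\<close> dominates the weights at all \<open>w\<close> in the unit disc around \<open>z\<close>.\<close>
    define W where "W t = 2 + cmod z + norm (V t)" for t
    have W: "W \<in> L1_loc a b" unfolding W_def[abs_def] by (intro L1_loc_add L1_loc_const V)
    define K where "K = 2 * \<bar>oint x0 x (\<lambda>t. norm (fst (D t)))\<bar> * exp (4 * \<bar>oint x0 x W\<bar>)"
    have "norm (Y w x - Y z x - ((w - z) *\<^sub>C fst (D x), (w - z) *\<^sub>C snd (D x))) \<le> K * (cmod (w - z))\<^sup>2"
      if "cmod (w - z) \<le> 1" for w
    proof -
      define c where "c = w - z"
      have wz: "w = z + c" and w: "cmod c \<le> 1" using that by (simp_all add: c_def)
      define T where "T p = (c *\<^sub>C fst p, c *\<^sub>C snd p)" for p :: "'h \<times> 'h"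
      have T: "bounded_linear T"
        unfolding T_def[abs_def]
        by (intro bounded_linear_Pair bounded_linear_compose[OF scaleC.bounded_linear_right]
            bounded_linear_fst bounded_linear_snd)
      define P where "P t = Y z t + T (D t)" for t
      let ?g = "\<lambda>t. schroedinger_field V z f t (Y z t) + T (schroedinger_field V z (\<lambda>t. fst (Y z t)) t (D t))"
      have gL: "?g \<in> L1_loc a b"
        by (intro L1_loc_add L1_loc_bounded_linear[OF T] integral_solution_field_L1_loc[OF f Y]
            integral_solution_field_L1_loc[OF y D])
      have Peq: "P t = (h0, h1) + oint x0 t ?g" if t: "t \<in> ?I" for t
      proof -
        have "oint x0 t ?g = oint x0 t (\<lambda>t. schroedinger_field V z f t (Y z t)) +
            T (oint x0 t (\<lambda>t. schroedinger_field V z (\<lambda>t. fst (Y z t)) t (D t)))"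
          by (simp add: oint_add[OF x0 t integral_solution_field_L1_loc[OF f Y]
                L1_loc_bounded_linear[OF T integral_solution_field_L1_loc[OF y D]]]
              oint_bounded_linear[OF x0 t T integral_solution_field_L1_loc[OF y D]])
        moreover have "Y z t = (h0, h1) + oint x0 t (\<lambda>t. schroedinger_field V z f t (Y z t))"
          using Y t unfolding integral_solution_def by blast
        moreover have "D t = oint x0 t (\<lambda>t. schroedinger_field V z (\<lambda>t. fst (Y z t)) t (D t))"
          using D t unfolding integral_solution_def by (simp add: zero_prod_def[symmetric])
        ultimately show ?thesis unfolding P_def by (simp add: add.assoc)
      qed
      have defect: "norm (?g t - schroedinger_field V w f t (P t)) = (cmod c)\<^sup>2 * norm (fst (D t))" if t: "t \<in> ?I" for t
      proof -
        have "V t (c *\<^sub>C fst (D t)) = c *\<^sub>C V t (fst (D t))"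
          using lin[OF t] by (simp add: complex_linear_def)
        then have "?g t - schroedinger_field V w f t (P t) = (0, (c * c) *\<^sub>C fst (D t))"
          by (simp add: wz schroedinger_field_def P_def T_def blinfun.add_right scaleC.add_right
              scaleC.add_left scaleC.diff_right scaleC_scaleC algebra_simps)
        then show ?thesis by (simp add: norm_Pair norm_mult power2_eq_square)
      qed
      have "norm (Y w x - P x) \<le> 2 * (norm ((h0, h1) - (h0, h1)) +
          \<bar>oint x0 x (\<lambda>t. norm (?g t - schroedinger_field V w f t (P t)))\<bar>) * exp (4 * \<bar>oint x0 x (schroedinger_weight V w)\<bar>)"
        by (rule integral_solution_perturbation[OF f Y gL Peq x])
      also have "oint x0 x (\<lambda>t. norm (?g t - schroedinger_field V w f t (P t))) = oint x0 x (\<lambda>t. (cmod c)\<^sup>2 * norm (fst (D t)))"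
        using einterval_segment_subset[OF x0 x] by (intro oint_cong defect) auto
      also have "\<dots> = (cmod c)\<^sup>2 * oint x0 x (\<lambda>t. norm (fst (D t)))" by (rule oint_cmult)
      also have "2 * (norm ((h0, h1) - (h0, h1)) + \<bar>(cmod c)\<^sup>2 * oint x0 x (\<lambda>t. norm (fst (D t)))\<bar>) *
          exp (4 * \<bar>oint x0 x (schroedinger_weight V w)\<bar>)
        = (2 * \<bar>oint x0 x (\<lambda>t. norm (fst (D t)))\<bar> * (cmod c)\<^sup>2) * exp (4 * \<bar>oint x0 x (schroedinger_weight V w)\<bar>)"
        by (simp add: abs_mult)
      also have "\<dots> \<le> (2 * \<bar>oint x0 x (\<lambda>t. norm (fst (D t)))\<bar> * (cmod c)\<^sup>2) * exp (4 * \<bar>oint x0 x W\<bar>)"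
      proof -
        have "cmod w \<le> cmod z + 1" using w norm_triangle_ineq[of z c] by (simp add: wz)
        then have "norm (oint x0 x (schroedinger_weight V w)) \<le> \<bar>oint x0 x W\<bar>"
          by (intro norm_oint_le[OF x0 x wl W]) (auto simp: schroedinger_weight_def W_def)
        then show ?thesis by (intro mult_left_mono) auto
      qed
      finally show ?thesis by (simp add: K_def P_def T_def c_def[symmetric] diff_diff_eq mult_ac)
    qed
    then show ?thesis by blast
  qed
  then obtain D K where DK: "\<And>z w. cmod (w - z) \<le> 1 \<Longrightarrow>
      norm (Y w x - Y z x - ((w - z) *\<^sub>C fst (D z), (w - z) *\<^sub>C snd (D z))) \<le> K z * (cmod (w - z))\<^sup>2"
    by metis
  show "entire (\<lambda>z. fst (Y z x))" unfolding entire_def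
  proof
    fix z
    have "norm (fst (Y w x) - fst (Y z x) - (w - z) *\<^sub>C fst (D z)) \<le> K z * (cmod (w - z))\<^sup>2" if "cmod (w - z) \<le> 1" for w
      using order_trans[OF norm_fst_le_norm DK[OF that]] by simp
    then show "\<exists>D. ((\<lambda>w. inverse (w - z) *\<^sub>C (fst (Y w x) - fst (Y z x))) \<longlongrightarrow> D) (at z)"
      by (intro exI inverse_scaleC_tendsto)
  qed
  show "entire (\<lambda>z. snd (Y z x))" unfolding entire_def
  proof
    fix z
    have "norm (snd (Y w x) - snd (Y z x) - (w - z) *\<^sub>C snd (D z)) \<le> K z * (cmod (w - z))\<^sup>2" if "cmod (w - z) \<le> 1" for w
      using order_trans[OF norm_snd_le_norm DK[OF that]] by simp
    then show "\<exists>D. ((\<lambda>w. inverse (w - z) *\<^sub>C (snd (Y w x) - snd (Y z x))) \<longlongrightarrow> D) (at z)"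
      by (intro exI inverse_scaleC_tendsto)
  qed
qed

end

theorem theorem2p3:
  fixes a b :: ereal
    and V :: "real \<Rightarrow> 'h \<Rightarrow>\<^sub>L ('h::{complex_hilbert_space, second_countable_topology})"
    and x0 :: real
  assumes "\<And>x. x \<in> einterval a b \<Longrightarrow> complex_linear (V x)"
    and "weakly_measurable a b V"
    and "(\<lambda>x. norm (V x)) \<in> L1_loc a b"
    and "x0 \<in> einterval a b"
  shows "\<exists>(y :: complex \<Rightarrow> 'h \<Rightarrow> 'h \<Rightarrow> (real \<Rightarrow> 'h) \<Rightarrow> real \<Rightarrow> 'h)
          (E :: 'h \<Rightarrow> 'h \<Rightarrow> (real \<Rightarrow> 'h) \<Rightarrow> real set).
    (\<forall>h0 h1. \<forall>f \<in> L1_loc a b.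
       E h0 h1 f \<in> null_sets lebesgue \<and>
       (\<forall>z. solves_ivp a b V z x0 h0 h1 f (E h0 h1 f) (y z h0 h1 f) \<and>
            (\<forall>N u. N \<in> null_sets lebesgue \<and> solves_ivp a b V z x0 h0 h1 f N u \<longrightarrow>
                   (\<forall>x \<in> einterval a b. u x = y z h0 h1 f x))))
    \<and> (\<forall>x \<in> einterval a b. \<forall>z. \<exists>C>0. \<forall>h0 h1 k0 k1. \<forall>f \<in> L1_loc a b. \<forall>g \<in> L1_loc a b.
         norm (y z h0 h1 f x - y z k0 k1 g x)
           \<le> C * (norm (h0 - k0) + norm (h1 - k1)
                  + set_lebesgue_integral lebesgue (closed_segment x0 x) (\<lambda>t. norm (f t - g t))))
    \<and> (\<forall>h0 h1. \<forall>f \<in> L1_loc a b.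
         (\<forall>z. y z h0 h1 f C1_differentiable_on einterval a b)
       \<and> (\<forall>z. \<forall>x \<in> einterval a b - E h0 h1 f.
            strong_deriv (y z h0 h1 f) differentiable (at x))
       \<and> (\<forall>x \<in> einterval a b.
            entire (\<lambda>z. y z h0 h1 f x) \<and> entire (\<lambda>z. strong_deriv (y z h0 h1 f) x)))"
proof -
  note V = assms(2,3) and x0 = assms(4)
  let ?I = "einterval a b"
  define Y where "Y z h0 h1 f = (SOME Y. integral_solution a b V z x0 h0 h1 f Y)" for z h0 h1 f
  have Y: "integral_solution a b V z x0 h0 h1 f (Y z h0 h1 f)" if "f \<in> L1_loc a b" for z h0 h1 f
    unfolding Y_def by (rule someI_ex[OF integral_solution_exists[OF V x0 that]])
  define exceptional where "exceptional f E \<longleftrightarrow> E \<in> null_sets lebesgue \<and> (\<forall>x \<in> ?I - E. lebesgue_point f x \<and>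
      (\<forall>y. continuous_on ?I y \<longrightarrow> lebesgue_point (\<lambda>t. V t (y t)) x))" for f :: "real \<Rightarrow> 'h" and E
  define E where "E f = (SOME E. exceptional f E)" for f
  have "\<exists>E. exceptional f E" if "f \<in> L1_loc a b" for f
    unfolding exceptional_def by (rule exceptional_set[OF V x0 that]) blast
  then have "exceptional f (E f)" if "f \<in> L1_loc a b" for f
    unfolding E_def using that by (intro someI_ex[of "exceptional f"])
  then have E: "f \<in> L1_loc a b \<Longrightarrow> E f \<in> null_sets lebesgue"
    "f \<in> L1_loc a b \<Longrightarrow> x \<in> ?I - E f \<Longrightarrow> lebesgue_point f x"
    "f \<in> L1_loc a b \<Longrightarrow> x \<in> ?I - E f \<Longrightarrow> continuous_on ?I y \<Longrightarrow> lebesgue_point (\<lambda>t. V t (y t)) x" for f x y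
    unfolding exceptional_def by blast+
  define y where "y z h0 h1 f = (\<lambda>t. fst (Y z h0 h1 f t))" for z h0 h1 f
  have sol: "solves_ivp a b V z x0 h0 h1 f (E f) (y z h0 h1 f)" if f: "f \<in> L1_loc a b" for z h0 h1 f
    unfolding y_def by (rule integral_solution_solves_ivp[OF V x0 f Y[OF f]]) (use E f in auto)
  show ?thesis
  proof (intro exI[of _ y] exI[of _ "\<lambda>h0 h1. E"] conjI allI ballI impI)
    fix h0 h1 :: 'h and f :: "real \<Rightarrow> 'h" and z N u x
    assume f: "f \<in> L1_loc a b" and "N \<in> null_sets lebesgue \<and> solves_ivp a b V z x0 h0 h1 f N u" and x: "x \<in> ?I"
    then have "integral_solution a b V z x0 h0 h1 f (\<lambda>x. (u x, strong_deriv u x))"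
      by (intro solves_ivp_integral_solution[OF V x0]) auto
    from integral_solution_unique[OF V x0 f this Y[OF f] x] show "u x = y z h0 h1 f x"
      by (simp add: y_def prod_eq_iff)
  next
    fix x z assume x: "x \<in> ?I"
    show "\<exists>C>0. \<forall>h0 h1 k0 k1. \<forall>f \<in> L1_loc a b. \<forall>g \<in> L1_loc a b.
         norm (y z h0 h1 f x - y z k0 k1 g x) \<le> C * (norm (h0 - k0) + norm (h1 - k1)
                  + set_lebesgue_integral lebesgue (closed_segment x0 x) (\<lambda>t. norm (f t - g t)))"
    proof (intro exI conjI allI ballI)
      show "0 < 2 * exp (4 * \<bar>oint x0 x (schroedinger_weight V z)\<bar>)" by simp
      fix h0 h1 k0 k1 :: 'h and f g :: "real \<Rightarrow> 'h" assume f: "f \<in> L1_loc a b" and g: "g \<in> L1_loc a b"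
      have "norm (y z h0 h1 f x - y z k0 k1 g x) \<le> norm (Y z h0 h1 f x - Y z k0 k1 g x)"
        unfolding y_def fst_diff[symmetric] by (rule norm_fst_le_norm)
      also note integral_solution_dependence[OF V x0 f Y[OF f] g Y[OF g] x]
      finally show "norm (y z h0 h1 f x - y z k0 k1 g x) \<le>
          2 * exp (4 * \<bar>oint x0 x (schroedinger_weight V z)\<bar>) * (norm (h0 - k0) + norm (h1 - k1)
                  + set_lebesgue_integral lebesgue (closed_segment x0 x) (\<lambda>t. norm (f t - g t)))"
        by (simp add: abs_oint_eq_set_integral_segment)
    qed
  next
    fix h0 h1 :: 'h and f :: "real \<Rightarrow> 'h" and z assume f: "f \<in> L1_loc a b"
    show "y z h0 h1 f C1_differentiable_on ?I"
      unfolding y_def by (rule integral_solution_C1[OF V x0 f Y[OF f]])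
  next
    fix h0 h1 :: 'h and f :: "real \<Rightarrow> 'h" and z x assume "f \<in> L1_loc a b" "x \<in> ?I - E f"
    then show "strong_deriv (y z h0 h1 f) differentiable (at x)"
      using sol unfolding solves_ivp_def by blast
  next
    fix h0 h1 :: 'h and f :: "real \<Rightarrow> 'h" and x assume f: "f \<in> L1_loc a b" and x: "x \<in> ?I"
    show "entire (\<lambda>z. y z h0 h1 f x)"
      unfolding y_def by (rule integral_solution_entire(1)[OF V x0 assms(1) f Y[OF f] x])
    have "strong_deriv (y z h0 h1 f) x = snd (Y z h0 h1 f x)" for z
      unfolding y_def by (rule integral_solution_strong_deriv[OF V x0 f Y[OF f] x])
    then show "entire (\<lambda>z. strong_deriv (y z h0 h1 f) x)"
      using integral_solution_entire(2)[OF V x0 assms(1) f Y[OF f] x] by simp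
  qed (use E sol in auto)
qed

end
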